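(* Let $k\ge 1$. Every $k$-connected finite graph $G$ has a cycle $C$ with $$\Delta(G\setminus C)\leq \frac{1}{k+1}|G\setminus C|+3.$$
   Context: A single vertex, a single edge, and the empty set are all considered to be cycles. $G\setminus C$ denotes the induced subgraph of $G$ on $V(G)\setminus V(C)$, $|G\setminus C|$ its number of vertices, and $\Delta$ the maximum degree; the maximum degree of the graph with no vertices is taken to be $-\tfrac12$. *)

theory Defs
  imports Complex_Main "Graph_Theory.Digraph_Component" "Graph_Theory.Vertex_Walk"
begin

text \<open>
  A finite simple graph is a digraph satisfying \<^locale>\<open>graph\<close>: finite, loop-free, without
  parallel arcs, and symmetric. Each undirected edge is a pair of opposite arcs, so the degree of
  a vertex is its out-degree.
\<close>

definition delete_verts :: "('a, 'b) pre_digraph \<Rightarrow> 'a set \<Rightarrow> ('a, 'b) pre_digraph" where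
  "delete_verts G X = G \<restriction> (verts G - X)"

text \<open>The usual convention that a \<open>k\<close>-connected graph has more than \<open>k\<close> vertices.\<close>

definition k_connected :: "nat \<Rightarrow> ('a, 'b) pre_digraph \<Rightarrow> bool" where
  "k_connected k G \<longleftrightarrow> card (verts G) > k \<and>
     (\<forall>X \<subseteq> verts G. card X < k \<longrightarrow> Digraph_Component.connected (delete_verts G X))"

definition max_degree :: "('a, 'b) pre_digraph \<Rightarrow> real" where
  "max_degree G =
     (if verts G = {} then - 1 / 2 else real (Max (out_degree G ` verts G)))"

text \<open>
  A cycle is given by the list of its vertices in cyclic order, without repeating the first one at
  the end. The empty set, single vertices and single edges count as cycles.
\<close>

definition is_cycle :: "('a, 'b) pre_digraph \<Rightarrow> 'a list \<Rightarrow> bool" where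
  "is_cycle G C \<longleftrightarrow>
     C = [] \<or>
     (\<exists>v \<in> verts G. C = [v]) \<or>
     (\<exists>u v. u \<rightarrow>\<^bsub>G\<^esub> v \<and> C = [u, v]) \<or>
     (length C \<ge> 3 \<and> distinct C \<and> vwalk C G \<and> last C \<rightarrow>\<^bsub>G\<^esub> hd C)"

end

theory Submission
  imports Defs
begin

text \<open>
  Write \<open>H = G \ C\<close>. Let \<open>t\<close> be the least value of \<open>\<Delta>(H)\<close> over all cycles, and choose \<open>C\<close> with
  \<open>\<Delta>(H) = t\<close>, a vertex \<open>v\<close> of degree \<open>t\<close> in \<open>H\<close> and a fan of \<open>k\<close> paths from \<open>v\<close> to \<open>C\<close>
  (which exists by Menger's theorem) so as to minimise, in this order, the number of vertices of
  degree \<open>t\<close> in \<open>H\<close>, the total length of the fan, and the length of \<open>C\<close>.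

  Starting after each end of the fan, release vertices of \<open>C\<close> one by one as long as this creates
  no new vertex of degree \<open>t\<close> outside the cycle. A whole segment between consecutive ends cannot be
  released, as the cycle could be rerouted through \<open>v\<close>. So each release is stopped at some vertex
  \<open>z\<close> by a vertex \<open>w\<close>, equal or adjacent to \<open>z\<close>, whose degree would reach \<open>t\<close>. Minimality of
  \<open>|C|\<close> forbids shortcuts, so at most \<open>3\<close> of the neighbours of \<open>w\<close> are among the released vertices
  and \<open>z\<close>, and \<open>w\<close> has degree at least \<open>t - 3\<close> in \<open>H\<close>. A common neighbour in \<open>H\<close> of two such
  vertices, or of one of them and \<open>v\<close>, would again allow rerouting \<open>C\<close> through \<open>v\<close>, or else to
  shorten the fan. Hence the \<open>k + 1\<close> neighbourhoods are disjoint and \<open>t + k (t - 3) \<le> |H|\<close>.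
\<close>

section \<open>Menger's theorem\<close>

definition walk_betw :: "('a \<times> 'a) set \<Rightarrow> 'a set \<Rightarrow> 'a set \<Rightarrow> 'a list \<Rightarrow> bool" where
  "walk_betw E A B p \<longleftrightarrow>
     p \<noteq> [] \<and> hd p \<in> A \<and> last p \<in> B \<and> successively (\<lambda>u v. (u, v) \<in> E) p"

definition separates :: "('a \<times> 'a) set \<Rightarrow> 'a set \<Rightarrow> 'a set \<Rightarrow> 'a set \<Rightarrow> bool" where
  "separates E A B S \<longleftrightarrow> (\<forall>p. walk_betw E A B p \<longrightarrow> set p \<inter> S \<noteq> {})"

definition disjoint_lists :: "'a list set \<Rightarrow> bool" where
  "disjoint_lists P \<longleftrightarrow> (\<forall>p\<in>P. \<forall>q\<in>P. p \<noteq> q \<longrightarrow> set p \<inter> set q = {})"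

lemma successively_weaken:
  assumes "successively P xs" "\<And>as u v bs. xs = as @ u # v # bs \<Longrightarrow> P u v \<Longrightarrow> Q u v"
  shows "successively Q xs"
  using assms
proof (induction xs rule: induct_list012)
  case (3 x y zs)
  have "P x y" "successively P (y # zs)" using 3(3) by auto
  moreover have "Q x y" using 3(4)[of "[]" x y zs] \<open>P x y\<close> by simp
  moreover have "successively Q (y # zs)"
    by (rule 3(2)[OF \<open>successively P (y # zs)\<close>]) (metis 3(4) append_Cons)
  ultimately show ?case by simp
qed auto

lemma successively_split:
  "successively P (as @ u # bs) \<longleftrightarrow> successively P (as @ [u]) \<and> successively P (u # bs)"
  by (cases bs) (auto simp: successively_append_iff)

lemma walk_betw_split:
  "walk_betw E A B (as @ u # bs) \<longleftrightarrow> walk_betw E A {u} (as @ [u]) \<and> walk_betw E {u} B (u # bs)"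
  unfolding walk_betw_def successively_split[of _ as u bs] by (auto simp: hd_append)

lemma walk_betw_mono:
  "walk_betw E A B p \<Longrightarrow> E \<subseteq> E' \<Longrightarrow> A \<subseteq> A' \<Longrightarrow> B \<subseteq> B' \<Longrightarrow> walk_betw E' A' B' p"
  by (auto simp: walk_betw_def elim: successively_mono)

lemma walk_betw_rev: "walk_betw (E\<inverse>) B A (rev p) \<longleftrightarrow> walk_betw E A B p"
  by (auto simp: walk_betw_def hd_rev last_rev)

text \<open>Each walk is cut at its first vertex in \<open>B\<close>. Disjointness makes these ends
  distinct, so the walks can be indexed by them.\<close>

lemma truncated_linkage:
  assumes "finite P" "\<forall>p\<in>P. walk_betw E A B p" "disjoint_lists P"
  obtains X f where "X \<subseteq> B" "card X = card P"
    and "\<And>s. s \<in> X \<Longrightarrow> walk_betw E A {s} (f s)"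
    and "\<And>s. s \<in> X \<Longrightarrow> set (butlast (f s)) \<inter> B = {}"
    and "\<And>s r. s \<in> X \<Longrightarrow> r \<in> X \<Longrightarrow> s \<noteq> r \<Longrightarrow> set (f s) \<inter> set (f r) = {}"
proof -
  have "\<exists>q. walk_betw E A B q \<and> set (butlast q) \<inter> B = {} \<and> set q \<subseteq> set p" if "p \<in> P" for p
  proof -
    have w: "walk_betw E A B p" using assms that by auto
    then have "\<exists>x\<in>set p. x \<in> B" by (auto simp: walk_betw_def)
    from split_list_first_prop[OF this] obtain as u bs where p: "p = as @ u # bs" "u \<in> B" "\<forall>y\<in>set as. y \<notin> B"
      by blast
    have "walk_betw E A B (as @ [u])"
      using w p(2) unfolding p(1) walk_betw_split[of E A B as u bs] by (auto elim: walk_betw_mono)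
    with p show ?thesis by (intro exI[of _ "as @ [u]"]) auto
  qed
  then obtain g where g: "\<And>p. p \<in> P \<Longrightarrow> walk_betw E A B (g p)"
    "\<And>p. p \<in> P \<Longrightarrow> set (butlast (g p)) \<inter> B = {}" "\<And>p. p \<in> P \<Longrightarrow> set (g p) \<subseteq> set p"
    by metis
  have last_in: "last (g p) \<in> set p" if "p \<in> P" for p
    using g(1,3)[OF that] by (auto simp: walk_betw_def)
  have inj: "inj_on (\<lambda>p. last (g p)) P"
    using last_in assms(3) unfolding inj_on_def disjoint_lists_def
    by (metis disjoint_iff)
  define X where "X = (\<lambda>p. last (g p)) ` P"
  define h where "h s = inv_into P (\<lambda>p. last (g p)) s" for s
  have h: "h s \<in> P" "last (g (h s)) = s" if "s \<in> X" for s
    using that inv_into_into[of s "\<lambda>p. last (g p)" P] f_inv_into_f[of s "\<lambda>p. last (g p)" P]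
    unfolding X_def h_def by blast+
  show thesis
  proof (rule that[of X "\<lambda>s. g (h s)"])
    show "X \<subseteq> B" using g(1) by (auto simp: X_def walk_betw_def)
    show "card X = card P" unfolding X_def using inj by (rule card_image)
    show "walk_betw E A {s} (g (h s))" if "s \<in> X" for s
      using g(1)[OF h(1)[OF that]] h(2)[OF that] by (simp add: walk_betw_def)
    show "set (butlast (g (h s))) \<inter> B = {}" if "s \<in> X" for s
      using g(2)[OF h(1)[OF that]] .
    show "set (g (h s)) \<inter> set (g (h r)) = {}" if "s \<in> X" "r \<in> X" "s \<noteq> r" for s r
    proof -
      have "h s \<noteq> h r" using h(2) that by metis
      then have "set (h s) \<inter> set (h r) = {}"
        using assms(3) h(1) that unfolding disjoint_lists_def by blast
      then show ?thesis using g(3)[OF h(1)] that by blast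
    qed
  qed
qed

text \<open>Every vertex of a walk but the last starts a step; if \<open>x\<close> can occur only at
  the end, the arc \<open>(x, y)\<close> is never traversed.\<close>

lemma walk_avoiding_source:
  assumes "successively (\<lambda>u v. (u, v) \<in> insert (x, y) E) (as @ [u])" "x \<notin> set as"
  shows "successively (\<lambda>u v. (u, v) \<in> E) (as @ [u])"
  using assms(1)
proof (rule successively_weaken)
  fix bs a b cs
  assume "as @ [u] = bs @ a # b # cs" "(a, b) \<in> insert (x, y) E"
  moreover from this have "as = bs @ a # butlast (b # cs)"
    by (metis butlast_append butlast_snoc butlast.simps(2) list.distinct(1))
  ultimately show "(a, b) \<in> E" using assms(2) by auto
qed

lemma walk_avoiding_target:
  assumes "successively (\<lambda>u v. (u, v) \<in> insert (x, y) E) (u # as)" "y \<notin> set as"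
  shows "successively (\<lambda>u v. (u, v) \<in> E) (u # as)"
  using assms(1)
proof (rule successively_weaken)
  fix bs a b cs
  assume "u # as = bs @ a # b # cs" "(a, b) \<in> insert (x, y) E"
  moreover from this have "b \<in> set as" by (cases bs) auto
  ultimately show "(a, b) \<in> E" using assms(2) by auto
qed

text \<open>A walk that misses \<open>x\<close> or \<open>y\<close> cannot use the new arc, so it is
  a walk of \<open>E\<close> and meets \<open>S\<close>.\<close>

lemma separates_insert_edge:
  assumes "separates E A B S"
  shows "separates (insert (x, y) E) A B (insert x S)"
    and "separates (insert (x, y) E) A B (insert y S)"
proof -
  have *: "walk_betw E A B p"
    if "walk_betw (insert (x, y) E) A B p" "x \<notin> set p \<or> y \<notin> set p" for p
  proof -
    have p: "p \<noteq> []" using that by (auto simp: walk_betw_def)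
    show ?thesis
    proof (cases "x \<in> set p")
      case False
      then show ?thesis
        using that(1) walk_avoiding_source[of x y E "butlast p" "last p"] p
        by (auto simp: walk_betw_def dest: in_set_butlastD)
    next
      case True
      then have "y \<notin> set (tl p)" using that(2) by (metis list.sel(2) list.set_sel(2))
      then show ?thesis
        using that(1) walk_avoiding_target[of x y E "hd p" "tl p"] p
        by (auto simp: walk_betw_def)
    qed
  qed
  show "separates (insert (x, y) E) A B (insert x S)"
    using * assms unfolding separates_def by blast
  show "separates (insert (x, y) E) A B (insert y S)"
    using * assms unfolding separates_def by blast
qed

text \<open>
  Goering's proof: remove an edge \<open>(x, y)\<close>; if this creates a separator \<open>S\<close> that is too small,
  then both \<open>S \<union> {x}\<close> and \<open>S \<union> {y}\<close> are minimum separators of the original graph, and linkages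
  from \<open>A\<close> to the former and from the latter to \<open>B\<close> are glued along \<open>S\<close> and the edge.
\<close>

theorem menger:
  assumes "finite E" "finite A" "finite B"
    and "\<And>S. finite S \<Longrightarrow> separates E A B S \<Longrightarrow> k \<le> card S"
  shows "\<exists>P. finite P \<and> card P = k \<and> (\<forall>p\<in>P. walk_betw E A B p) \<and> disjoint_lists P"
  using assms
proof (induction E arbitrary: A B k rule: finite_induct)
  case empty
  have "separates {} A B (A \<inter> B)"
    unfolding separates_def
  proof (intro allI impI)
    fix p :: "'a list"
    assume p: "walk_betw {} A B p"
    then obtain a q where "p = a # q" by (cases p) (auto simp: walk_betw_def)
    with p show "set p \<inter> (A \<inter> B) \<noteq> {}" by (cases q) (auto simp: walk_betw_def)
  qed
  then have "k \<le> card (A \<inter> B)" using empty by auto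
  then obtain K where K: "K \<subseteq> A \<inter> B" "card K = k" "finite K"
    by (metis obtain_subset_with_card_n)
  show ?case
    using K by (intro exI[of _ "(\<lambda>a. [a]) ` K"])
      (auto simp: card_image inj_on_def walk_betw_def disjoint_lists_def)
next
  case (insert e E)
  obtain x y where e: "e = (x, y)" by force
  have mono: "walk_betw (insert e E) A B p" if "walk_betw E A B p" for p A B
    using that by (auto simp: walk_betw_def elim: successively_mono)
  show ?case
  proof (cases "\<forall>S. finite S \<and> separates E A B S \<longrightarrow> k \<le> card S")
    case True
    then obtain P where "finite P" "card P = k" "\<forall>p\<in>P. walk_betw E A B p" "disjoint_lists P"
      using insert.IH[OF insert.prems(1,2), of k] by blast
    then show ?thesis using mono by blast
  next
    case False
    then obtain S where S: "finite S" "separates E A B S" "card S < k" by force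
    have sx: "separates (insert e E) A B (insert x S)" and sy: "separates (insert e E) A B (insert y S)"
      using separates_insert_edge[OF S(2)] e by auto
    have "k \<le> card (insert x S)" "k \<le> card (insert y S)"
      using insert.prems(3) sx sy S(1) by auto
    then have xS: "x \<notin> S" "card (insert x S) = k" and yS: "y \<notin> S" "card (insert y S) = k"
      using S by (auto simp: card_insert_if split: if_splits)
    \<comment> \<open>Up to its first vertex in \<open>insert x S\<close> a walk does not use the
      removed arc, so \<open>R\<close> meets that initial piece. Hence \<open>R\<close> has at least
      \<open>k\<close> vertices, as the induction hypothesis requires.\<close>
    have sepA: "separates (insert e E) A B R" if R: "separates E A (insert x S) R" for R
      unfolding separates_def
    proof (intro allI impI)
      fix p assume p: "walk_betw (insert e E) A B p"
      then have "\<exists>u\<in>set p. u \<in> insert x S" using sx by (auto simp: separates_def)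
      from split_list_first_prop[OF this] obtain as u bs where as: "p = as @ u # bs" "u \<in> insert x S" "\<forall>z\<in>set as. z \<notin> insert x S"
        by blast
      have pw: "walk_betw (insert e E) A {u} (as @ [u])"
        using p as(1) walk_betw_split[of "insert e E" A B as u bs] by metis
      have "x \<notin> set as" using as(3) by blast
      then have "successively (\<lambda>u v. (u, v) \<in> E) (as @ [u])"
        using pw walk_avoiding_source[of x y E as u] by (simp add: walk_betw_def e)
      then have "walk_betw E A (insert x S) (as @ [u])"
        using pw as(2) by (simp add: walk_betw_def)
      then show "set p \<inter> R \<noteq> {}" using R as(1) by (fastforce simp: separates_def)
    qed
    have sepB: "separates (insert e E) A B R" if R: "separates E (insert y S) B R" for R
      unfolding separates_def
    proof (intro allI impI)
      fix p assume p: "walk_betw (insert e E) A B p"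
      then have "\<exists>u\<in>set p. u \<in> insert y S" using sy by (auto simp: separates_def)
      from split_list_last_prop[OF this] obtain as u bs where as: "p = as @ u # bs" "u \<in> insert y S" "\<forall>z\<in>set bs. z \<notin> insert y S"
        by blast
      have pw: "walk_betw (insert e E) {u} B (u # bs)"
        using p as(1) walk_betw_split[of "insert e E" A B as u bs] by metis
      have "y \<notin> set bs" using as(3) by blast
      then have "successively (\<lambda>u v. (u, v) \<in> E) (u # bs)"
        using pw walk_avoiding_target[of x y E u bs] by (simp add: walk_betw_def e)
      then have "walk_betw E (insert y S) B (u # bs)"
        using pw as(2) by (simp add: walk_betw_def)
      then show "set p \<inter> R \<noteq> {}" using R as(1) by (fastforce simp: separates_def)
    qed
    have fin: "finite (insert x S)" "finite (insert y S)" using S by auto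
    obtain P where P: "finite P" "card P = k" "\<forall>p\<in>P. walk_betw E A (insert x S) p" "disjoint_lists P"
      using insert.IH[OF insert.prems(1) fin(1), of k] insert.prems(3) sepA by blast
    obtain Q where Q: "finite Q" "card Q = k" "\<forall>p\<in>Q. walk_betw E (insert y S) B p" "disjoint_lists Q"
      using insert.IH[OF fin(2) insert.prems(2), of k] insert.prems(3) sepB by blast
    obtain X a where a: "X \<subseteq> insert x S" "card X = card P"
      "\<And>s. s \<in> X \<Longrightarrow> walk_betw E A {s} (a s)"
      "\<And>s. s \<in> X \<Longrightarrow> set (butlast (a s)) \<inter> insert x S = {}"
      "\<And>s r. s \<in> X \<Longrightarrow> r \<in> X \<Longrightarrow> s \<noteq> r \<Longrightarrow> set (a s) \<inter> set (a r) = {}"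
      using truncated_linkage[OF P(1,3,4)] by blast
    have X: "X = insert x S" using a(1,2) fin P(2) xS(2) by (metis card_subset_eq)
    \<comment> \<open>Reversing the walks lets the truncation cut at the last vertex in
      \<open>insert y S\<close> instead of the first.\<close>
    have "card (rev ` Q) = k" using Q by (simp add: card_image)
    moreover have "\<forall>p\<in>rev ` Q. walk_betw (E\<inverse>) B (insert y S) p" "disjoint_lists (rev ` Q)"
      using Q by (auto simp: walk_betw_rev disjoint_lists_def)
    moreover have "finite (rev ` Q)" using Q by simp
    ultimately obtain Y b' where b': "Y \<subseteq> insert y S" "card Y = k"
      "\<And>s. s \<in> Y \<Longrightarrow> walk_betw (E\<inverse>) B {s} (b' s)"
      "\<And>s. s \<in> Y \<Longrightarrow> set (butlast (b' s)) \<inter> insert y S = {}"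
      "\<And>s r. s \<in> Y \<Longrightarrow> r \<in> Y \<Longrightarrow> s \<noteq> r \<Longrightarrow> set (b' s) \<inter> set (b' r) = {}"
      using truncated_linkage[of "rev ` Q" "E\<inverse>" B "insert y S"] by metis
    have Y: "Y = insert y S" using b'(1,2) fin yS(2) by (metis card_subset_eq)
    define b where "b s = rev (b' s)" for s
    have b: "walk_betw E {s} B (b s)" "set (tl (b s)) \<inter> insert y S = {}" if "s \<in> insert y S" for s
      using b'(3,4)[of s] that Y walk_betw_rev[of E B "{s}" "b s"]
      by (auto simp: b_def butlast_rev[symmetric] simp flip: rev_swap)
        (metis butlast_rev disjoint_iff insertCI rev_rev_ident set_rev)+
    have b_disj: "set (b s) \<inter> set (b r) = {}" if "s \<in> insert y S" "r \<in> insert y S" "s \<noteq> r" for s r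
      using b'(5) that Y by (simp add: b_def)
    note a' = a(3-5)[unfolded X]
    \<comment> \<open>Splicing at a common vertex \<open>u\<close> gives a walk of \<open>E\<close>
      from \<open>A\<close> to \<open>B\<close>, which must meet \<open>S\<close>. The pieces can do
      so only at the end of the first and the start of the second, so \<open>u\<close> is that
      vertex.\<close>
    have meet: "u = s \<and> u = r \<and> u \<in> S"
      if sr: "s \<in> insert x S" "r \<in> insert y S" and u: "u \<in> set (a s)" "u \<in> set (b r)" for s r u
    proof -
      obtain p1 p2 where p: "a s = p1 @ u # p2" using u(1) by (metis split_list)
      obtain q1 q2 where q: "b r = q1 @ u # q2" using u(2) by (metis split_list)
      have "walk_betw E A {u} (p1 @ [u])"
        using a'(1)[OF sr(1)] p walk_betw_split[of E A "{s}" p1 u p2] by metis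
      moreover have "walk_betw E {u} B (u # q2)"
        using b(1)[OF sr(2)] q walk_betw_split[of E "{r}" B q1 u q2] by metis
      ultimately have "walk_betw E A B (p1 @ u # q2)"
        using walk_betw_split[of E A B p1 u q2] by metis
      then obtain m where m: "m \<in> set (p1 @ u # q2)" "m \<in> S"
        using S(2) unfolding separates_def by blast
      have "set q2 \<subseteq> set (tl (b r))" using q by (cases q1) auto
      then have m1: "m \<in> set (p1 @ [u])" using m b(2)[OF sr(2)] by auto
      have "p2 = []"
      proof (rule ccontr)
        assume "p2 \<noteq> []"
        then have "m \<in> set (butlast (a s))" using m1 p by (auto simp: butlast_append)
        then show False using a'(2)[OF sr(1)] m by auto
      qed
      then have "u = s" using a'(1)[OF sr(1)] p by (auto simp: walk_betw_def)
      moreover have "m \<notin> set p1" using a'(2)[OF sr(1)] m p \<open>p2 = []\<close> by (auto simp: butlast_append)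
      ultimately have "u = m" using m1 by auto
      moreover have "u \<notin> set (tl (b r))" using b(2)[OF sr(2)] m \<open>u = m\<close> by auto
      then have "u = hd (b r)" using u(2) by (cases "b r") auto
      then have "u = r" using b(1)[OF sr(2)] by (auto simp: walk_betw_def)
      ultimately show ?thesis using \<open>u = s\<close> m by auto
    qed
    \<comment> \<open>Paths sharing an end in \<open>S\<close> are joined there, dropping the second
      copy; the one ending in \<open>x\<close> crosses the removed arc to \<open>y\<close>.\<close>
    define h where "h s = a s @ (if s = x then b y else tl (b s))" for s
    have hw: "walk_betw (insert e E) A B (h s)" if s: "s \<in> insert x S" for s
    proof (cases "s = x")
      case True
      have "walk_betw (insert e E) A {x} (a x)" "walk_betw (insert e E) {y} B (b y)"
        using mono a'(1) b(1) by auto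
      then show ?thesis using True e
        by (auto simp: h_def walk_betw_def successively_append_iff)
    next
      case False
      then have "s \<in> S" using s by simp
      then have "walk_betw E A {s} (a s)" "walk_betw E {s} B (b s)" using a'(1) b(1) by auto
      then have "walk_betw E A B (a s @ tl (b s))"
        by (cases "b s"; cases "tl (b s)") (auto simp: walk_betw_def successively_append_iff)
      then show ?thesis using False mono by (simp add: h_def)
    qed
    have hd: "set (h s) \<inter> set (h r) = {}" if sr: "s \<in> insert x S" "r \<in> insert x S" "s \<noteq> r" for s r
    proof -
      define \<beta> where "\<beta> s = (if s = x then y else s)" for s
      have \<beta>: "\<beta> s \<in> insert y S" "\<beta> r \<in> insert y S" "\<beta> s \<noteq> \<beta> r"
        using sr xS yS by (auto simp: \<beta>_def)
      have sub: "set (h s) \<subseteq> set (a s) \<union> set (b (\<beta> s))" for s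
        by (cases "b s") (auto simp: h_def \<beta>_def)
      have "set (a s) \<inter> set (b (\<beta> r)) = {}"
        using meet[OF sr(1) \<beta>(2)] sr(3) yS(1) unfolding \<beta>_def by (metis disjoint_iff)
      moreover have "set (a r) \<inter> set (b (\<beta> s)) = {}"
        using meet[OF sr(2) \<beta>(1)] sr(3) yS(1) unfolding \<beta>_def by (metis disjoint_iff)
      ultimately show ?thesis using sub[of s] sub[of r] a'(3)[OF sr] b_disj[OF \<beta>] by blast
    qed
    have "inj_on h (insert x S)"
    proof (rule inj_onI, rule ccontr)
      fix s r assume sr: "s \<in> insert x S" "r \<in> insert x S" "h s = h r" "s \<noteq> r"
      then have "set (h s) = {}" using hd by fastforce
      then show False using hw[OF sr(1)] by (simp add: walk_betw_def)
    qed
    then have "card (h ` insert x S) = k" using xS by (metis card_image)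
    then show ?thesis
      using fin(1) hw hd by (intro exI[of _ "h ` insert x S"]) (auto simp: disjoint_lists_def)
  qed
qed

section \<open>Cycles and fans\<close>

lemma rtranclp_imp_list:
  assumes "R\<^sup>*\<^sup>* x y"
  shows "\<exists>p. p \<noteq> [] \<and> hd p = x \<and> last p = y \<and> successively R p"
  using assms
proof (induction rule: rtranclp_induct)
  case base
  show ?case by (intro exI[of _ "[x]"]) auto
next
  case (step y z)
  then obtain p where "p \<noteq> []" "hd p = x" "last p = y" "successively R p" by blast
  with step show ?case
    by (intro exI[of _ "p @ [z]"]) (auto simp: successively_append_iff)
qed

lemma walk_betw_distinct:
  assumes "walk_betw E A B p"
  shows "\<exists>q. walk_betw E A B q \<and> distinct q \<and> set q \<subseteq> set p"
  using assms
proof (induction "length p" arbitrary: p rule: less_induct)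
  case less
  show ?case
  proof (cases "distinct p")
    case False
    then obtain as bs cs u where p: "p = as @ [u] @ bs @ [u] @ cs" by (metis not_distinct_decomp)
    have "walk_betw E A {u} (as @ [u])"
      using less.prems p walk_betw_split[of E A B as u "bs @ [u] @ cs"] by (metis append_Cons append_Nil)
    moreover have "walk_betw E {u} B (u # cs)"
      using less.prems p walk_betw_split[of E A B "as @ [u] @ bs" u cs] by simp
    ultimately have "walk_betw E A B (as @ u # cs)" using walk_betw_split[of E A B as u cs] by metis
    from less.hyps[OF _ this] show ?thesis unfolding p by fastforce
  qed (use less.prems in blast)
qed

lemma successively_set_Range:
  "successively (\<lambda>u v. (u, v) \<in> E) p \<Longrightarrow> set p \<subseteq> insert (hd p) (Range E)"
  by (induction p rule: induct_list012) auto

locale simple_graph =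
  fixes V :: "'a set" and E :: "'a \<Rightarrow> 'a \<Rightarrow> bool"
  assumes finite_V: "finite V"
    and E_in_V: "E u v \<Longrightarrow> u \<in> V \<and> v \<in> V"
    and E_sym: "E u v \<Longrightarrow> E v u"
    and E_irrefl: "\<not> E u u"
begin

text \<open>Lists of length 0 and 1 need no adjacency. At length 2 the closing edge is the only edge
  traversed backwards, so a single edge counts too.\<close>

definition cyc :: "'a list \<Rightarrow> bool" where
  "cyc C \<longleftrightarrow> set C \<subseteq> V \<and> distinct C \<and> (2 \<le> length C \<longrightarrow> successively E C \<and> E (last C) (hd C))"

definition deg :: "'a set \<Rightarrow> 'a \<Rightarrow> nat" where
  "deg S u = card {w \<in> S. E u w}"

definition bounded_outside :: "nat \<Rightarrow> 'a list \<Rightarrow> bool" where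
  "bounded_outside t C \<longleftrightarrow> cyc C \<and> (\<forall>u\<in>V - set C. deg (V - set C) u \<le> t)"

definition top_outside :: "nat \<Rightarrow> 'a list \<Rightarrow> 'a set" where
  "top_outside t C = {u \<in> V - set C. deg (V - set C) u = t}"

text \<open>A path is indexed by its end \<open>x\<close>; \<open>F x\<close> holds only its
  interior, which is empty when the path is the edge from \<open>v\<close> to
  \<open>x\<close>.\<close>

definition fan :: "nat \<Rightarrow> 'a set \<Rightarrow> 'a \<Rightarrow> 'a set \<Rightarrow> ('a \<Rightarrow> 'a list) \<Rightarrow> bool" where
  "fan m B v X F \<longleftrightarrow> X \<subseteq> B \<and> card X = m
     \<and> (\<forall>x\<in>X. successively E (v # F x @ [x]) \<and> distinct (F x) \<and> set (F x) \<subseteq> V - B - {v})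
     \<and> (\<forall>x\<in>X. \<forall>y\<in>X. x \<noteq> y \<longrightarrow> set (F x) \<inter> set (F y) = {})"

definition fan_length :: "'a set \<Rightarrow> ('a \<Rightarrow> 'a list) \<Rightarrow> nat" where
  "fan_length X F = (\<Sum>x\<in>X. length (F x))"

lemma deg_mono: "S \<subseteq> S' \<Longrightarrow> S' \<subseteq> V \<Longrightarrow> deg S u \<le> deg S' u"
  unfolding deg_def using finite_V by (intro card_mono) (auto intro: finite_subset)

lemma successively_sym_rev: "successively E p \<Longrightarrow> successively E (rev p)"
  by (auto elim!: successively_mono intro: E_sym)

lemma finite_top_outside: "finite (top_outside t C)"
  using finite_V by (auto simp: top_outside_def)

text \<open>Used to compare the fan of a cycle with that of a rerouted one. Each path is cut at its
  first vertex in \<open>B'\<close>, which exists because the old ends lie in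
  \<open>B'\<close>.\<close>

lemma fan_truncate:
  assumes "fan m B v X F" "B \<subseteq> V" "X \<subseteq> B'" "v \<notin> B'"
  obtains X' F' where "fan m B' v X' F'" "fan_length X' F' \<le> fan_length X F"
    "(\<exists>x\<in>X. set (F x) \<inter> B' \<noteq> {}) \<Longrightarrow> fan_length X' F' < fan_length X F"
proof -
  have X: "X \<subseteq> B" "card X = m"
    and F: "\<And>x. x \<in> X \<Longrightarrow> successively E (v # F x @ [x])" "\<And>x. x \<in> X \<Longrightarrow> distinct (F x)"
      "\<And>x. x \<in> X \<Longrightarrow> set (F x) \<subseteq> V - B - {v}"
    and disj: "\<And>x y. x \<in> X \<Longrightarrow> y \<in> X \<Longrightarrow> x \<noteq> y \<Longrightarrow> set (F x) \<inter> set (F y) = {}"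
    using assms(1) unfolding fan_def by blast+
  have finX: "finite X" using X assms(2) finite_V by (meson finite_subset)
  have "\<exists>as u bs. F x @ [x] = as @ u # bs \<and> u \<in> B' \<and> (\<forall>y\<in>set as. y \<notin> B')" if "x \<in> X" for x
  proof -
    have "\<exists>y\<in>set (F x @ [x]). y \<in> B'" using that assms(3) by auto
    from split_list_first_prop[OF this] show ?thesis by blast
  qed
  then obtain g e r where g: "\<And>x. x \<in> X \<Longrightarrow> F x @ [x] = g x @ e x # r x"
    "\<And>x. x \<in> X \<Longrightarrow> e x \<in> B'" "\<And>x. x \<in> X \<Longrightarrow> \<forall>y\<in>set (g x). y \<notin> B'"
    by metis
  have in_F: "insert (e x) (set (g x)) \<subseteq> insert x (set (F x))" if "x \<in> X" for x
    using arg_cong[OF g(1)[OF that], of set] by auto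
  \<comment> \<open>Ends lie in \<open>B\<close> and interiors avoid \<open>B\<close>, so the paths
    stay disjoint with their ends added.\<close>
  have disj': "insert x (set (F x)) \<inter> insert y (set (F y)) = {}"
    if "x \<in> X" "y \<in> X" "x \<noteq> y" for x y
    using disj[OF that] F(3) that X(1) by fastforce
  have inj: "inj_on e X"
    using in_F disj' by (intro inj_onI) blast
  define F' where "F' y = g (inv_into X e y)" for y
  have F': "F' (e x) = g x" if "x \<in> X" for x
    unfolding F'_def using inj that by simp
  have len: "length (g x) \<le> length (F x)" if "x \<in> X" for x
    using arg_cong[OF g(1)[OF that], of length] by simp
  have len': "length (g x) < length (F x)" if x: "x \<in> X" "set (F x) \<inter> B' \<noteq> {}" for x
  proof (rule ccontr)
    assume "\<not> length (g x) < length (F x)"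
    then have "length (g x) = length (F x)" using len x by force
    then have "g x = F x" using g(1)[OF x(1)] by (metis append_eq_append_conv)
    then show False using g(3)[OF x(1)] x(2) by auto
  qed
  have sum: "fan_length (e ` X) F' = (\<Sum>x\<in>X. length (g x))"
    unfolding fan_length_def using inj F' by (simp add: sum.reindex)
  show thesis
  proof (rule that)
    have "successively E (v # g x @ [e x])" "distinct (g x)" "set (g x) \<subseteq> V - B' - {v}" if x: "x \<in> X" for x
    proof -
      have "successively E ((v # g x) @ e x # r x)" using F(1)[OF x] g(1)[OF x] by simp
      then show "successively E (v # g x @ [e x])"
        using successively_split[of E "v # g x" "e x" "r x"] by simp
      have "distinct (F x @ [x])" using F(2,3)[OF x] x X(1) by auto
      then show "distinct (g x)" using g(1)[OF x] by simp
      have "insert x (set (F x)) \<subseteq> V - {v}" using F(3)[OF x] X(1) x assms(2-4) by auto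
      then show "set (g x) \<subseteq> V - B' - {v}" using in_F[OF x] g(3)[OF x] by blast
    qed
    moreover have "set (g x) \<inter> set (g y) = {}" if "x \<in> X" "y \<in> X" "e x \<noteq> e y" for x y
      using disj'[of x y] in_F that by blast
    ultimately show "fan m B' v (e ` X) F'"
      unfolding fan_def using F' g(2) inj X(2) by (auto simp: card_image)
    show "fan_length (e ` X) F' \<le> fan_length X F"
      unfolding sum unfolding fan_length_def using len by (rule sum_mono)
    show "fan_length (e ` X) F' < fan_length X F" if hit: "\<exists>x\<in>X. set (F x) \<inter> B' \<noteq> {}"
      unfolding sum unfolding fan_length_def
    proof (rule sum_strict_mono_ex1[OF finX])
      show "\<forall>x\<in>X. length (g x) \<le> length (F x)" using len by blast
      show "\<exists>x\<in>X. length (g x) < length (F x)" using len' hit by meson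
    qed
  qed
qed

end

locale k_connected_graph = simple_graph +
  fixes k :: nat
  assumes k_pos: "1 \<le> k"
    and card_V: "k < card V"
    and connected_minus: "X \<subseteq> V \<Longrightarrow> card X < k \<Longrightarrow> u \<in> V - X \<Longrightarrow> w \<in> V - X \<Longrightarrow>
      (\<lambda>a b. E a b \<and> a \<notin> X \<and> b \<notin> X)\<^sup>*\<^sup>* u w"
begin

text \<open>Menger's theorem between the neighbours of \<open>v\<close> and \<open>B\<close>, with
  \<open>v\<close> deleted: fewer than \<open>m \<le> k\<close> vertices cannot separate, since
  connectivity yields a walk from \<open>v\<close> to a vertex of \<open>B\<close> avoiding them.
  The case \<open>m < k\<close> serves cycles shorter than \<open>k\<close>.\<close>

lemma fan_exists:
  assumes v: "v \<in> V" "v \<notin> B" and B: "B \<subseteq> V" and m: "m \<le> k" "m \<le> card B"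
  obtains X F where "fan m B v X F"
proof -
  define E' where "E' = {(a, b). E a b \<and> a \<noteq> v \<and> b \<noteq> v}"
  define A where "A = {a. E v a}"
  have "E' \<subseteq> V \<times> V" "A \<subseteq> V" using E_in_V by (auto simp: E'_def A_def)
  then have fin: "finite E'" "finite A" "finite B"
    using finite_V B by (auto intro: finite_subset)
  have sep: "m \<le> card S" if S: "finite S" "separates E' A B S" for S
  proof (rule ccontr)
    assume "\<not> m \<le> card S"
    moreover define S' where "S' = S \<inter> V - {v}"
    moreover have "card S' \<le> card S" unfolding S'_def using S(1) by (intro card_mono) auto
    ultimately have S': "card S' < m" "S' \<subseteq> V" "v \<notin> S'" by auto
    then have "\<not> B \<subseteq> S'" using m(2) card_mono[of S' B] finite_V by (metis finite_subset leD order_less_le_trans)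
    then obtain b where b: "b \<in> B" "b \<notin> S'" by blast
    have "(\<lambda>a b. E a b \<and> a \<notin> S' \<and> b \<notin> S')\<^sup>*\<^sup>* v b"
      using connected_minus[OF S'(2), of v b] S' m v b B by auto
    from rtranclp_imp_list[OF this] obtain p where p: "p \<noteq> []" "hd p = v" "last p = b"
      "successively (\<lambda>a b. E a b \<and> a \<notin> S' \<and> b \<notin> S') p" by blast
    have "v \<in> set p" using p by (metis hd_in_set)
    \<comment> \<open>After its last visit to \<open>v\<close> the walk starts at a neighbour of
      \<open>v\<close> and stays in the graph without \<open>v\<close>.\<close>
    then obtain as bs where as: "p = as @ v # bs" "v \<notin> set bs" by (metis split_list_last)
    have bs: "bs \<noteq> []" using p(3) as b v(2) by auto
    have succ: "successively (\<lambda>a b. E a b \<and> a \<notin> S' \<and> b \<notin> S') (v # bs)"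
      using p(4) successively_split[of _ as v bs] as(1) by blast
    have avoid: "y \<in> V - S'" if "y \<in> set bs" for y
    proof -
      have "set (v # bs) \<subseteq> insert (hd (v # bs)) (Range {(a, b). E a b \<and> a \<notin> S' \<and> b \<notin> S'})"
        by (rule successively_set_Range) (use succ in simp)
      then show ?thesis using that as(2) E_in_V by auto
    qed
    have "successively (\<lambda>u v. (u, v) \<in> E') bs"
    proof (rule successively_weaken)
      show "successively (\<lambda>a b. E a b \<and> a \<notin> S' \<and> b \<notin> S') bs"
        using succ bs by (cases bs) auto
      show "(a, b) \<in> E'" if "bs = xs @ a # b # ys" "E a b \<and> a \<notin> S' \<and> b \<notin> S'" for xs a b ys
        using that as(2) by (auto simp: E'_def)
    qed
    moreover have "hd bs \<in> A" using succ bs by (cases bs) (auto simp: A_def)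
    moreover have "last bs \<in> B" using p(3) as bs b by auto
    ultimately have "walk_betw E' A B bs" using bs by (simp add: walk_betw_def)
    then have "set bs \<inter> S \<noteq> {}" using S(2) by (simp add: separates_def)
    then show False using avoid as(2) by (auto simp: S'_def)
  qed
  obtain P where P: "finite P" "card P = m" "\<forall>p\<in>P. walk_betw E' A B p" "disjoint_lists P"
    using menger[OF fin sep] by blast
  obtain X f where X: "X \<subseteq> B" "card X = card P"
    and f: "\<And>s. s \<in> X \<Longrightarrow> walk_betw E' A {s} (f s)"
      "\<And>s. s \<in> X \<Longrightarrow> set (butlast (f s)) \<inter> B = {}"
      "\<And>s r. s \<in> X \<Longrightarrow> r \<in> X \<Longrightarrow> s \<noteq> r \<Longrightarrow> set (f s) \<inter> set (f r) = {}"
    using truncated_linkage[OF P(1,3,4)] by blast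
  obtain q where q: "\<And>s. s \<in> X \<Longrightarrow> walk_betw E' A {s} (q s)" "\<And>s. s \<in> X \<Longrightarrow> distinct (q s)"
    "\<And>s. s \<in> X \<Longrightarrow> set (q s) \<subseteq> set (f s)"
    using walk_betw_distinct[OF f(1)] by metis
  have qs: "q s = butlast (q s) @ [s]" if "s \<in> X" for s
    using q(1)[OF that] by (metis append_butlast_last_id singletonD walk_betw_def)
  have "fan m B v X (\<lambda>s. butlast (q s))"
    unfolding fan_def
  proof (intro conjI ballI impI)
    show "X \<subseteq> B" "card X = m" using X P by auto
    fix s assume s: "s \<in> X"
    have "successively E (q s)" "E v (hd (q s))" "q s \<noteq> []"
      using q(1)[OF s] by (auto simp: walk_betw_def E'_def A_def elim: successively_mono)
    then have "successively E (v # q s)" by (cases "q s") auto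
    then show "successively E (v # butlast (q s) @ [s])" using qs[OF s] by simp
    show "distinct (butlast (q s))" using q(2)[OF s] by (simp add: distinct_butlast)
    have "set (q s) \<subseteq> insert (hd (q s)) (Range E')"
      using q(1)[OF s] by (auto simp: walk_betw_def dest: successively_set_Range)
    moreover have "insert (hd (q s)) (Range E') \<subseteq> V - {v}"
      using \<open>E v (hd (q s))\<close> E_in_V E_irrefl by (auto simp: E'_def)
    moreover have "set (butlast (q s)) \<inter> B = {}"
    proof -
      have "s \<notin> set (butlast (q s))" using q(2)[OF s] qs[OF s] by (metis distinct_append disjoint_iff list.set_intros(1))
      moreover have "set (f s) \<subseteq> insert s (set (butlast (f s)))"
        using f(1)[OF s] by (cases "f s" rule: rev_cases) (auto simp: walk_betw_def)
      moreover have "set (butlast (q s)) \<subseteq> set (f s)"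
        using q(3)[OF s] by (auto dest: in_set_butlastD)
      ultimately show ?thesis using f(2)[OF s] by blast
    qed
    ultimately show "set (butlast (q s)) \<subseteq> V - B - {v}" by (auto dest: in_set_butlastD)
    fix r assume r: "r \<in> X" "s \<noteq> r"
    show "set (butlast (q s)) \<inter> set (butlast (q r)) = {}"
      using f(3)[OF s r] q(3) s r by (auto dest!: in_set_butlastD)
  qed
  then show thesis by (rule that)
qed

end

section \<open>Minimal configurations\<close>

text \<open>The lexicographic choice, as assumptions. Since \<open>v_top\<close> makes
  \<open>\<tau>\<close> positive, \<open>top_minimal\<close> also encodes that no cycle leaves
  maximum degree below \<open>t\<close>. By \<open>C_0\<close> the list starts at a fan end, so gaps
  between ends are intervals of indices.\<close>

locale minimal_configuration = k_connected_graph +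
  fixes t \<tau> :: nat and C :: "'a list" and v :: 'a and X :: "'a set" and F :: "'a \<Rightarrow> 'a list"
  assumes top_minimal: "bounded_outside t C' \<Longrightarrow> \<tau> \<le> card (top_outside t C')"
    and C_bounded: "bounded_outside t C"
    and card_top: "card (top_outside t C) = \<tau>"
    and v_top: "v \<in> top_outside t C"
    and C_fan: "fan k (set C) v X F"
    and configuration_minimal:
      "bounded_outside t C' \<Longrightarrow> card (top_outside t C') = \<tau> \<Longrightarrow> v' \<in> top_outside t C' \<Longrightarrow>
       fan k (set C') v' X' F' \<Longrightarrow>
       fan_length X F < fan_length X' F' \<or>
       (fan_length X F = fan_length X' F' \<and> length C \<le> length C')"
    and C_0: "C ! 0 \<in> X"
begin

abbreviation H :: "'a set" where "H \<equiv> V - set C"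

definition fan_verts :: "'a set" where "fan_verts = insert v (\<Union>x\<in>X. set (F x))"

text \<open>
  Vertices of the cycle that may be released: a cycle that loses only vertices of \<open>S\<close> has no
  more vertices of degree \<open>t\<close> outside it than \<open>C\<close> has.
\<close>

definition releasable :: "'a set \<Rightarrow> bool" where
  "releasable S \<longleftrightarrow>
     (\<forall>u\<in>H \<union> S. deg (H \<union> S) u \<le> t \<and> (deg (H \<union> S) u = t \<longrightarrow> u \<in> top_outside t C))"

lemma C_cyc: "cyc C" using C_bounded by (simp add: bounded_outside_def)

lemma C_subset: "set C \<subseteq> V" and C_distinct: "distinct C"
  using C_cyc by (auto simp: cyc_def)

lemma v_H: "v \<in> H" and deg_v: "deg H v = t"
  using v_top by (auto simp: top_outside_def)

lemma X_subset: "X \<subseteq> set C" and card_X: "card X = k"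
  using C_fan by (auto simp: fan_def)

lemma fan_path: "x \<in> X \<Longrightarrow> successively E (v # F x @ [x])"
  and fan_distinct: "x \<in> X \<Longrightarrow> distinct (F x)"
  and fan_outside: "x \<in> X \<Longrightarrow> set (F x) \<subseteq> H - {v}"
  and fan_disjoint: "x \<in> X \<Longrightarrow> y \<in> X \<Longrightarrow> x \<noteq> y \<Longrightarrow> set (F x) \<inter> set (F y) = {}"
  using C_fan unfolding fan_def by blast+

lemma fan_verts_H: "fan_verts \<subseteq> H"
  using v_H fan_outside by (auto simp: fan_verts_def)

text \<open>Degrees outside \<open>C'\<close> are at most those in \<open>H \<union> S\<close>, so a
  vertex of degree \<open>t\<close> there already had degree \<open>t\<close> outside
  \<open>C\<close>. Minimality of \<open>\<tau>\<close> forces the two sets of such vertices to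
  agree, and \<open>v\<close> stays off \<open>C'\<close>.\<close>

lemma releasable_cycle:
  assumes "releasable S" "S \<subseteq> V" "cyc C'" "set C - S \<subseteq> set C'"
  shows "bounded_outside t C'" "top_outside t C' = top_outside t C" "v \<notin> set C'"
proof -
  have sub: "V - set C' \<subseteq> H \<union> S" and "H \<union> S \<subseteq> V" using assms(2,4) by auto
  then have le: "deg (V - set C') u \<le> deg (H \<union> S) u" for u by (intro deg_mono)
  show b: "bounded_outside t C'"
    unfolding bounded_outside_def
  proof (intro conjI ballI)
    fix u assume "u \<in> V - set C'"
    then have "deg (H \<union> S) u \<le> t" using assms(1) sub unfolding releasable_def by blast
    then show "deg (V - set C') u \<le> t" using le[of u] by linarith
  qed (rule assms(3))
  have "u \<in> top_outside t C" if u: "u \<in> top_outside t C'" for u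
  proof -
    have "u \<in> H \<union> S" "deg (V - set C') u = t" using u sub by (auto simp: top_outside_def)
    moreover from this have "deg (H \<union> S) u \<le> t" using assms(1) unfolding releasable_def by blast
    ultimately show ?thesis using assms(1) le[of u] unfolding releasable_def
      by (metis le_antisym)
  qed
  then show eq: "top_outside t C' = top_outside t C"
    using top_minimal[OF b] card_top finite_top_outside by (intro card_seteq) auto
  have "v \<in> top_outside t C'" using eq v_top by simp
  then show "v \<notin> set C'" by (simp add: top_outside_def)
qed

text \<open>The ends \<open>X\<close> stay on \<open>C'\<close>, so the old fan cut at
  \<open>C'\<close> is a fan for it. By minimality the cut shortens nothing, so \<open>C'\<close>
  misses the fan and is no shorter than \<open>C\<close>.\<close>

lemma releasable_cycle_fan:
  assumes "releasable S" "S \<subseteq> V" "S \<inter> X = {}" "cyc C'" "set C - S \<subseteq> set C'"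
  shows "set C' \<inter> fan_verts = {}" "length C \<le> length C'"
proof -
  note C' = releasable_cycle[OF assms(1,2,4,5)]
  have XC': "X \<subseteq> set C'" using X_subset assms(3,5) by auto
  obtain X' F' where F': "fan k (set C') v X' F'" "fan_length X' F' \<le> fan_length X F"
    "(\<exists>x\<in>X. set (F x) \<inter> set C' \<noteq> {}) \<Longrightarrow> fan_length X' F' < fan_length X F"
    using fan_truncate[OF C_fan C_subset XC' C'(3)] by metis
  have m: "fan_length X F < fan_length X' F' \<or>
       (fan_length X F = fan_length X' F' \<and> length C \<le> length C')"
    using configuration_minimal[OF C'(1) _ _ F'(1)] C'(2) card_top v_top by simp
  then show "length C \<le> length C'" using F'(2) by linarith
  have "\<not> (\<exists>x\<in>X. set (F x) \<inter> set C' \<noteq> {})" using m F'(2,3) by linarith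
  then show "set C' \<inter> fan_verts = {}" using C'(3) by (auto simp: fan_verts_def)
qed

section \<open>Cyclic indexing of \<open>C\<close> and its arcs\<close>

definition n :: nat where "n = length C"

text \<open>Reading indices modulo \<open>n\<close> makes an arc that passes the start of the list
  an interval of natural numbers.\<close>

definition c :: "nat \<Rightarrow> 'a" where "c j = C ! (j mod n)"

definition arc :: "nat \<Rightarrow> nat \<Rightarrow> 'a list" where "arc a b = map c [a..<Suc b]"

lemma X_nonempty: "X \<noteq> {}" using card_X k_pos by auto

lemma n_pos: "0 < n" using X_nonempty X_subset by (auto simp: n_def)

lemma c_add_n [simp]: "c (j + n) = c j" by (simp add: c_def)

lemma c_n [simp]: "c n = c 0" by (simp add: c_def)

lemma c_in_C [simp]: "c j \<in> set C" using n_pos by (simp add: c_def n_def)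

lemma c_in_V [simp]: "c j \<in> V" using c_in_C C_subset by blast

lemma c_inj: "i < j \<Longrightarrow> j < i + n \<Longrightarrow> c i \<noteq> c j"
proof
  assume ij: "i < j" "j < i + n" "c i = c j"
  then have "i mod n = j mod n"
    using nth_eq_iff_index_eq[OF C_distinct, of "i mod n" "j mod n"] n_pos by (simp add: c_def n_def)
  then have "n dvd j - i" using ij by (metis mod_eq_dvd_iff_nat less_imp_le)
  then show False using ij by (auto dest!: dvd_imp_le)
qed

lemma c_inj_on: "inj_on c {a..<a + n}"
proof (rule linorder_inj_onI')
  fix i j assume "i \<in> {a..<a + n}" "j \<in> {a..<a + n}" "i < j"
  then show "c i \<noteq> c j" by (intro c_inj) auto
qed

lemma c_image_disjoint:
  assumes "\<And>i j. i \<in> S \<Longrightarrow> j \<in> S' \<Longrightarrow> i < j \<and> j < i + n"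
  shows "c ` S \<inter> c ` S' = {}"
  using assms c_inj by blast

text \<open>\<open>c\<close> is injective on \<open>n\<close> consecutive indices and
  \<open>C\<close> has just \<open>n\<close> vertices. The window is open at \<open>b\<close> and
  closed at \<open>b + n\<close>, so \<open>c b\<close> comes last.\<close>

lemma C_window: "set C = c ` {b<..b + n}"
proof -
  have "card (c ` {b<..b + n}) = card {Suc b..<Suc b + n}"
    using c_inj_on[of "Suc b"] by (simp add: card_image atLeastLessThanSuc_atLeastAtMost
        flip: atLeastSucAtMost_greaterThanAtMost)
  then have "card (c ` {b<..b + n}) = card (set C)"
    using distinct_card[OF C_distinct] by (simp add: n_def)
  moreover have "c ` {b<..b + n} \<subseteq> set C" by auto
  ultimately show ?thesis by (metis List.finite_set card_subset_eq)
qed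

lemma c_adj: "2 \<le> n \<Longrightarrow> E (c j) (c (Suc j))"
proof -
  assume n: "2 \<le> n"
  then have C: "successively E C" "E (last C) (hd C)" using C_cyc by (auto simp: cyc_def n_def)
  have "C \<noteq> []" using n by (auto simp: n_def)
  then have l: "last C = C ! (n - 1)" "hd C = C ! 0" by (simp_all add: n_def last_conv_nth hd_conv_nth)
  show ?thesis
  proof (cases "Suc (j mod n) = n")
    case True
    then have "j mod n = n - 1" by simp
    then show ?thesis using True C(2) l by (simp add: c_def mod_Suc)
  next
    case False
    have "j mod n < n" using n by simp
    then have "Suc (j mod n) < length C" using False by (simp add: n_def)
    then show ?thesis using False successively_nth[OF C(1)] by (simp add: c_def mod_Suc)
  qed
qed

lemma set_arc: "set (arc a b) = c ` {a..b}"
  by (simp add: arc_def atLeastLessThanSuc_atLeastAtMost del: upt_Suc)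

lemma length_arc: "length (arc a b) = Suc b - a" by (simp add: arc_def del: upt_Suc)

lemma arc_Cons: "a \<le> b \<Longrightarrow> arc a b = c a # map c [Suc a..<Suc b]"
  by (simp add: arc_def upt_conv_Cons del: upt_Suc)

lemma arc_ends: "a \<le> b \<Longrightarrow> arc a b \<noteq> [] \<and> hd (arc a b) = c a \<and> last (arc a b) = c b"
  by (cases "a = b") (simp_all add: arc_Cons last_map)

lemma distinct_arc: "b < a + n \<Longrightarrow> distinct (arc a b)"
proof -
  assume "b < a + n"
  then have "{a..b} \<subseteq> {a..<a + n}" by auto
  from inj_on_subset[OF c_inj_on this] show ?thesis
    by (simp add: arc_def distinct_map atLeastLessThanSuc_atLeastAtMost del: upt_Suc)
qed

lemma successively_arc: "b < a + n \<Longrightarrow> successively E (arc a b)"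
proof (cases "2 \<le> n")
  case True
  have "successively (\<lambda>i j. E (c i) (c j)) [a..<Suc b]"
    by (rule successively_conv_nth[THEN iffD2]) (use c_adj[OF True] in \<open>auto simp del: upt_Suc\<close>)
  then show ?thesis by (simp add: arc_def successively_map)
next
  case False
  assume "b < a + n"
  then have "length (arc a b) \<le> 1" using False by (simp add: length_arc)
  then show ?thesis by (cases "arc a b") auto
qed

section \<open>Positions of the fan ends and the gaps between them\<close>

definition I :: "nat set" where "I = {p. p < n \<and> c p \<in> X}"

text \<open>The position of the next fan end; \<open>n\<close> stands for the first end, met again
  after a full turn. For \<open>k = 1\<close> the value \<open>Suc n\<close> puts the only end
  itself, at index \<open>n\<close>, among the candidates for release; releasing all of
  \<open>C\<close> is excluded by the cycle \<open>[v]\<close>.\<close>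

definition nx :: "nat \<Rightarrow> nat" where
  "nx p = (if k = 1 then Suc n else Min (insert n {q \<in> I. p < q}))"

lemma finite_I: "finite I" by (simp add: I_def)

lemma I_X: "p \<in> I \<Longrightarrow> c p \<in> X" and I_less: "p \<in> I \<Longrightarrow> p < n" by (auto simp: I_def)

lemma zero_I: "0 \<in> I" using C_0 n_pos by (simp add: I_def c_def)

lemma c_image_I: "c ` I = X"
proof -
  have "X \<subseteq> c ` {..<n}"
  proof
    fix x assume "x \<in> X"
    then obtain j where "j < n" "C ! j = x" using X_subset by (metis in_mono in_set_conv_nth n_def)
    then show "x \<in> c ` {..<n}" by (auto simp: c_def intro!: image_eqI[of _ _ j])
  qed
  then show ?thesis by (auto simp: I_def)
qed

lemma inj_on_I: "inj_on c I"
  by (rule inj_on_subset[OF c_inj_on[of 0]]) (auto simp: I_def)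

lemma card_I: "card I = k"
  using card_image[OF inj_on_I] c_image_I card_X by simp

lemma I_singleton: "k = 1 \<Longrightarrow> p \<in> I \<Longrightarrow> p = 0"
  using card_I zero_I by (metis card_1_singletonE singletonD)

lemma nx_gt: "p \<in> I \<Longrightarrow> p < nx p"
  using finite_I I_less[of p] by (auto simp: nx_def)

lemma nx_le: "k \<noteq> 1 \<Longrightarrow> nx p \<le> n"
  using finite_I by (auto simp: nx_def)

lemma nx_le_next: "p \<in> I \<Longrightarrow> p' \<in> I \<Longrightarrow> p < p' \<Longrightarrow> nx p \<le> p'"
  using finite_I I_singleton by (auto simp: nx_def intro!: Min_le)

lemma nx_I: "k \<noteq> 1 \<Longrightarrow> nx p = n \<or> nx p \<in> I"
proof -
  assume "k \<noteq> 1"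
  then have "nx p = Min (insert n {q \<in> I. p < q})" by (simp add: nx_def)
  also have "\<dots> \<in> insert n {q \<in> I. p < q}" using finite_I by (intro Min_in) auto
  finally show ?thesis by auto
qed

lemma nx_X: "k \<noteq> 1 \<Longrightarrow> c (nx p) \<in> X"
  using nx_I[of p] zero_I I_X[of "nx p"] I_X[of 0] by auto

lemma before_nx_notin_X: "p \<in> I \<Longrightarrow> p < j \<Longrightarrow> j < nx p \<Longrightarrow> j < n \<Longrightarrow> c j \<notin> X"
proof
  assume a: "p \<in> I" "p < j" "j < nx p" "j < n" "c j \<in> X"
  then have "j \<in> I" by (simp add: I_def)
  then have "nx p \<le> j" using a nx_le_next by blast
  then show False using a by simp
qed

end

section \<open>Rerouting the cycle\<close>

text \<open>In the gap after the end \<open>p\<close> the vertices strictly between \<open>p\<close>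
  and \<open>z p\<close> are released. By \<open>U_maximal\<close> no stop \<open>z p\<close> short
  of the end of its gap can move one step further.\<close>

locale maximal_release = minimal_configuration +
  fixes z :: "nat \<Rightarrow> nat"
  assumes z_gt: "p \<in> I \<Longrightarrow> p < z p"
    and z_le: "p \<in> I \<Longrightarrow> z p \<le> nx p"
    and U_releasable: "releasable (\<Union>p\<in>I. c ` {p<..<z p})"
    and U_maximal: "p \<in> I \<Longrightarrow> z p < nx p \<Longrightarrow>
      \<not> releasable (insert (c (z p)) (\<Union>p\<in>I. c ` {p<..<z p}))"
begin

definition U :: "'a set" where "U = (\<Union>p\<in>I. c ` {p<..<z p})"

lemma U_subset: "U \<subseteq> V" by (auto simp: U_def)

lemma z_le_n: "p \<in> I \<Longrightarrow> z p \<le> n"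
proof (cases "k = 1")
  case True
  assume p: "p \<in> I"
  then have p0: "p = 0" using I_singleton True by blast
  show ?thesis
  proof (rule ccontr)
    assume "\<not> z p \<le> n"
    \<comment> \<open>The released indices cover a full turn, so the single vertex \<open>v\<close>
      would be an admissible cycle, although \<open>v\<close> must stay off it.\<close>
    then have "set C \<subseteq> U"
      unfolding C_window[of 0] U_def using zero_I p0 by fastforce
    moreover have "cyc [v]" using v_H by (simp add: cyc_def)
    ultimately show False
      using releasable_cycle(3)[of U "[v]"] U_releasable U_subset by (auto simp: U_def)
  qed
next
  case False
  assume "p \<in> I"
  then show ?thesis using z_le nx_le[OF False] order_trans by blast
qed

lemma U_disjoint_X: "U \<inter> X = {}"
proof -
  have "c j \<notin> X" if "p \<in> I" "p < j" "j < z p" for p j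
    using before_nx_notin_X[OF that(1,2)] that z_le[of p] z_le_n[of p] by simp
  then show ?thesis by (auto simp: U_def)
qed

lemma segment_arc_disjoint: "c ` {b<..<a} \<inter> c ` {a..b + n} = {}"
  by (rule c_image_disjoint) auto

text \<open>\<open>M\<close> replaces the part of \<open>C\<close> between \<open>c b\<close> and
  \<open>c a\<close>, all of it released, and may reuse its vertices. The new cycle loses only
  released vertices and keeps the fan ends, so \<open>releasable_cycle_fan\<close> applies.\<close>

lemma detour:
  assumes p: "p \<in> I" "p \<le> b" "b < a" "a \<le> z p"
    and M: "distinct M" "successively E (c b # M @ [c a])" "set M \<inter> set C \<subseteq> c ` {b<..<a}"
  shows "set M \<inter> fan_verts = {}" "a - b \<le> Suc (length M)"
proof -
  have bn: "a \<le> b + n" using z_le_n[OF p(1)] p(4) by simp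
  define C' where "C' = M @ arc a (b + n)"
  have MV: "set M \<subseteq> V"
  proof -
    have "successively (\<lambda>u v. (u, v) \<in> {(u, v). E u v}) (c b # M @ [c a])" using M(2) by simp
    then show ?thesis using E_in_V successively_set_Range[of "{(u, v). E u v}"] by fastforce
  qed
  have "set M \<inter> set (arc a (b + n)) = {}"
    using M(3) segment_arc_disjoint[of b a] unfolding set_arc by fastforce
  then have "distinct C'" using M(1) distinct_arc[of "b + n" a] p(3) by (simp add: C'_def)
  moreover have "set C' \<subseteq> V" using MV by (auto simp: C'_def set_arc)
  moreover have "successively E C'"
  proof -
    have "successively E (M @ [c a])" using M(2) by (cases M) auto
    moreover have "successively E (arc a (b + n))" using successively_arc p(3) by simp
    ultimately have "successively E (M @ c a # map c [Suc a..<Suc (b + n)])"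
      using successively_split[of E M "c a" "map c [Suc a..<Suc (b + n)]"]
      unfolding arc_Cons[OF bn] by blast
    then show ?thesis unfolding C'_def arc_Cons[OF bn] .
  qed
  moreover have "E (last C') (hd C')"
  proof -
    have "E (c b) (hd (M @ [c a]))" using M(2) by (cases M) auto
    moreover have "last C' = c b" using arc_ends[OF bn] by (simp add: C'_def)
    moreover have "hd C' = hd (M @ [c a])" using arc_ends[OF bn] by (simp add: C'_def hd_append)
    ultimately show ?thesis by simp
  qed
  ultimately have cyc: "cyc C'" by (simp add: cyc_def)
  have "set C - U \<subseteq> set C'"
  proof
    fix y assume y: "y \<in> set C - U"
    then obtain j where j: "b < j" "j \<le> b + n" "y = c j" using C_window[of b] by auto
    have "a \<le> j"
    proof (rule ccontr)
      assume "\<not> a \<le> j"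
      then have "y \<in> c ` {p<..<z p}" using j p by auto
      then show False using y p(1) by (auto simp: U_def)
    qed
    then show "y \<in> set C'" using j by (auto simp: C'_def set_arc)
  qed
  note C' = releasable_cycle_fan[OF U_releasable[folded U_def] U_subset U_disjoint_X cyc this]
  show "set M \<inter> fan_verts = {}" using C'(1) by (auto simp: C'_def)
  have "n \<le> length M + (Suc (b + n) - a)" using C'(2) by (simp add: C'_def length_arc n_def)
  then show "a - b \<le> Suc (length M)" using p(3) bn by linarith
qed

text \<open>The cycle runs from \<open>v\<close> along the fan to \<open>c p'\<close>, back along
  \<open>C\<close> to \<open>c a\<close>, through \<open>M\<close> to \<open>c b\<close>, on along
  \<open>C\<close> to \<open>c (p + n) = c p\<close>, and home along the fan. It omits only released
  vertices of \<open>C\<close> but contains \<open>v\<close>, which is impossible.\<close>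

lemma double_detour_less:
  assumes p: "p \<in> I" "p' \<in> I" "p < p'" "p < a" "a \<le> z p" "p' < b" "b \<le> z p'"
    and M: "distinct M" "successively E (c a # M @ [c b])"
      "set M \<inter> set C \<subseteq> c ` {p<..<a} \<union> c ` {p'<..<b}" "set M \<inter> fan_verts = {}"
  shows False
proof -
  have ap: "a \<le> p'" using p nx_le_next[OF p(1-3)] z_le[OF p(1)] by simp
  have bn: "b \<le> p + n" using z_le_n[OF p(2)] p(7) by simp
  have X: "c p \<in> X" "c p' \<in> X" "c p \<noteq> c p'"
    using I_X p I_less[OF p(2)] c_inj[of p p'] by auto
  define G where "G = F (c p)"
  define G' where "G' = F (c p')"
  define A where "A = rev (arc a p')"
  define B where "B = arc b (p + n)"
  define C' where "C' = v # G' @ A @ M @ B @ rev G"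
  have A: "A \<noteq> []" "hd A = c p'" "last A = c a" "set A = c ` {a..p'}" "distinct A" "successively E A"
    using arc_ends[OF ap] distinct_arc[of p' a] successively_arc[of p' a] successively_sym_rev
      I_less[OF p(2)] by (auto simp: A_def hd_rev last_rev set_arc)
  have B: "B \<noteq> []" "hd B = c b" "last B = c p" "set B = c ` {b..p + n}" "distinct B" "successively E B"
    using arc_ends[OF bn] distinct_arc[of "p + n" b] successively_arc[of "p + n" b] p
    by (auto simp: B_def set_arc)
  have G: "distinct G" "successively E (v # G @ [c p])" "set G \<subseteq> H - {v}"
    and G': "distinct G'" "successively E (v # G' @ [c p'])" "set G' \<subseteq> H - {v}"
    and GG': "set G \<inter> set G' = {}"
    using fan_distinct fan_path fan_outside fan_disjoint X by (simp_all add: G_def G'_def)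
  have AB: "set A \<inter> set B = {}"
    unfolding A(4) B(4) using p by (intro c_image_disjoint) auto
  have AC: "set A \<subseteq> set C" "set B \<subseteq> set C" using A B by auto
  have MA: "set M \<inter> (set A \<union> set B) = {}"
  proof -
    have "c ` {p<..<a} \<inter> c ` {a..p'} = {}" "c ` {p<..<a} \<inter> c ` {b..p + n} = {}"
      "c ` {a..p'} \<inter> c ` {p'<..<b} = {}" "c ` {p'<..<b} \<inter> c ` {b..p + n} = {}"
      using p ap bn I_less[OF p(2)] by (auto intro!: c_image_disjoint)
    then have "(c ` {p<..<a} \<union> c ` {p'<..<b}) \<inter> (set A \<union> set B) = {}"
      unfolding A(4) B(4) by (simp add: Int_Un_distrib Int_Un_distrib2 Int_commute)
    then have "set M \<inter> set C \<inter> (set A \<union> set B) = {}"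
      using Int_mono[OF M(3) order_refl[of "set A \<union> set B"]] by simp
    then show ?thesis using AC by auto
  qed
  have MF: "v \<notin> set M" "set M \<inter> set G = {}" "set M \<inter> set G' = {}"
    using M(4) X by (auto simp: fan_verts_def G_def G'_def)
  have "distinct C'"
    unfolding C'_def using A(5) B(5) G(1,3) G'(1,3) GG' AB AC MA MF M(1) v_H by auto
  moreover have "set C' \<subseteq> V"
  proof -
    have "successively (\<lambda>u v. (u, v) \<in> {(u, v). E u v}) (c a # M @ [c b])" using M(2) by simp
    then have "set M \<subseteq> V" using E_in_V successively_set_Range[of "{(u, v). E u v}"] by fastforce
    then show ?thesis using AC C_subset G(3) G'(3) v_H by (auto simp: C'_def)
  qed
  moreover have "successively E C' \<and> E (last C') (hd C')"
  proof -
    have 1: "successively E (v # G')" "E (last (v # G')) (c p')"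
      using G'(2) successively_append_iff[of E "v # G'" "[c p']"] by auto
    have "successively E ((c p # rev G) @ [v])" using successively_sym_rev[OF G(2)] by simp
    then have r: "successively E (c p # rev G)" "E (last (c p # rev G)) v"
      unfolding successively_append_iff by simp_all
    have 2: "successively E (rev G)" "rev G \<noteq> [] \<Longrightarrow> E (c p) (hd (rev G))"
      using r(1) by (cases "rev G"; simp)+
    have "successively E ((c a # M) @ [c b])" using M(2) by simp
    then have r': "successively E (c a # M)" "E (last (c a # M)) (c b)"
      unfolding successively_append_iff by simp_all
    have 3: "successively E M" "M \<noteq> [] \<Longrightarrow> E (c a) (hd M)"
      using r'(1) by (cases M; simp)+
    have 4: "successively E (B @ rev G)" "hd (B @ rev G) = c b"
      using B(1-3,6) 2 unfolding successively_append_iff by auto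
    have 5: "successively E (M @ B @ rev G)" "E (c a) (hd (M @ B @ rev G))"
      using B(1) 3 4 r'(2) unfolding successively_append_iff[of E M] by (cases "M = []"; simp)+
    have 6: "successively E (A @ M @ B @ rev G)" "hd (A @ M @ B @ rev G) = c p'"
      using A(1-3,6) 5 unfolding successively_append_iff[of E A] by simp_all
    have "successively E ((v # G') @ A @ M @ B @ rev G)"
      using 1 6 successively_append_iff[of E "v # G'" "A @ M @ B @ rev G"] by simp
    moreover have "E (last C') v" using r(2) B(1,3) by (cases "G = []") (simp_all add: C'_def)
    ultimately show ?thesis by (simp add: C'_def)
  qed
  ultimately have cyc: "cyc C'" by (simp add: cyc_def)
  have "set C - U \<subseteq> set C'"
  proof
    fix y assume y: "y \<in> set C - U"
    then obtain j where j: "p < j" "j \<le> p + n" "y = c j" using C_window[of p] by auto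
    have "\<not> (p < j \<and> j < z p)" "\<not> (p' < j \<and> j < z p')" using y j p(1,2) by (auto simp: U_def)
    then have "j \<in> {a..p'} \<or> j \<in> {b..p + n}" using j p by auto
    then show "y \<in> set C'" using j A(4) B(4) by (auto simp: C'_def)
  qed
  from releasable_cycle(3)[OF U_releasable[folded U_def] U_subset cyc this]
  show False by (simp add: C'_def)
qed

lemma double_detour:
  assumes p: "p \<in> I" "p' \<in> I" "p \<noteq> p'" "p < a" "a \<le> z p" "p' < b" "b \<le> z p'"
    and M: "distinct M" "successively E (c a # M @ [c b])"
      "set M \<inter> set C \<subseteq> c ` {p<..<a} \<union> c ` {p'<..<b}" "set M \<inter> fan_verts = {}"
  shows False
proof (cases "p < p'")
  case True
  then show False using double_detour_less[OF p(1,2) True p(4-7) M] by blast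
next
  case False
  have "successively E (c b # rev M @ [c a])" using successively_sym_rev[OF M(2)] by simp
  then show False
    using double_detour_less[OF p(2,1) _ p(6,7,4,5), of "rev M"] M p(3) False by (simp add: Un_commute)
qed

text \<open>From \<open>c p\<close> follow its fan path towards \<open>v\<close>, stopping at
  \<open>u\<close> if it lies there; otherwise pass through \<open>v\<close> and out along the fan
  path containing \<open>u\<close>.\<close>

lemma fan_route:
  assumes "p \<in> I" "u \<in> fan_verts"
  obtains Q where "Q \<noteq> []" "last Q = u" "set Q \<subseteq> fan_verts" "distinct Q" "successively E (c p # Q)"
proof -
  have X: "c p \<in> X" using I_X assms by blast
  have r: "successively E (c p # rev (F (c p)) @ [v])" using successively_sym_rev[OF fan_path[OF X]] by simp
  have d: "distinct (rev (F (c p)) @ [v])" using fan_distinct[OF X] fan_outside[OF X] by auto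
  consider "u = v" | "u \<in> set (F (c p))" | x where "x \<in> X" "x \<noteq> c p" "u \<in> set (F x)"
    using assms(2) by (auto simp: fan_verts_def)
  then show thesis
  proof cases
    case 1
    then show ?thesis using r d X by (intro that[of "rev (F (c p)) @ [v]"]) (auto simp: fan_verts_def)
  next
    case 2
    then obtain as bs where F: "F (c p) = as @ u # bs" by (metis split_list)
    have "successively E ((c p # rev bs) @ u # rev as @ [v])" using r F by simp
    then have "successively E (c p # rev bs @ [u])"
      using successively_split[of E "c p # rev bs" u "rev as @ [v]"] by simp
    moreover have "distinct (rev bs @ [u])" using fan_distinct[OF X] F by auto
    moreover have "set (rev bs @ [u]) \<subseteq> set (F (c p))" using F by auto
    ultimately show ?thesis using X by (intro that[of "rev bs @ [u]"]) (auto simp: fan_verts_def)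
  next
    case (3 x)
    then obtain as bs where F: "F x = as @ u # bs" by (metis split_list)
    have "successively E ((v # as) @ u # bs @ [x])" using fan_path[OF 3(1)] F by simp
    then have "successively E (v # as @ [u])"
      using successively_split[of E "v # as" u "bs @ [x]"] by simp
    then have "successively E ((c p # rev (F (c p))) @ v # as @ [u])"
      using r successively_split[of E "c p # rev (F (c p))" v "as @ [u]"] by simp
    moreover have "distinct (rev (F (c p)) @ v # as @ [u])"
      using d fan_distinct[OF 3(1)] fan_outside[OF 3(1)] fan_disjoint[OF X 3(1)] 3(2) F by auto
    moreover have "set (as @ [u]) \<subseteq> set (F x)" using F by auto
    then have "set (rev (F (c p)) @ v # as @ [u]) \<subseteq> fan_verts"
      using X 3(1) by (auto simp: fan_verts_def)
    ultimately show ?thesis by (intro that[of "rev (F (c p)) @ v # as @ [u]"]) auto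
  qed
qed

text \<open>A fan route from \<open>c p\<close> to \<open>u\<close> followed by \<open>M\<close> is
  a detour from \<open>c p\<close> to \<open>c a\<close>, but it contains the fan vertex
  \<open>u\<close>, contrary to \<open>detour\<close>.\<close>

lemma no_link_to_fan:
  assumes p: "p \<in> I" "p < a" "a \<le> z p" and u: "u \<in> fan_verts"
    and M: "distinct M" "set M \<inter> fan_verts = {}" "set M \<inter> set C \<subseteq> c ` {p<..<a}"
      "successively E (u # M @ [c a])"
  shows False
proof -
  obtain Q where Q: "Q \<noteq> []" "last Q = u" "set Q \<subseteq> fan_verts" "distinct Q" "successively E (c p # Q)"
    using fan_route[OF p(1) u] .
  have "successively E ((c p # butlast Q) @ u # M @ [c a])"
    using Q M(4) successively_split[of E "c p # butlast Q" u "M @ [c a]"]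
    by (metis append_Cons append_butlast_last_id)
  then have "successively E (c p # (Q @ M) @ [c a])"
    using Q(1,2) by (metis append_Cons append_assoc append_butlast_last_id append_Nil)
  moreover have "distinct (Q @ M)" using Q M(1,2) by auto
  moreover have "set (Q @ M) \<inter> set C \<subseteq> c ` {p<..<a}" using M(3) Q(3) fan_verts_H by auto
  ultimately have "set (Q @ M) \<inter> fan_verts = {}"
    by (intro detour(1)[OF p(1) order_refl p(2,3)])
  moreover have "u \<in> set Q" using Q(1,2) last_in_set by blast
  ultimately show False using u by auto
qed

text \<open>For \<open>k \<noteq> 1\<close>, if a whole gap were released, the last vertex before
  the next end on its fan path would link the fan to \<open>c (z p)\<close>.\<close>

lemma z_less_nx: "p \<in> I \<Longrightarrow> z p < nx p"
proof (cases "k = 1")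
  case True
  assume "p \<in> I"
  moreover have "nx p = Suc n" unfolding nx_def using True by simp
  ultimately show ?thesis using z_le_n[of p] by linarith
next
  case False
  assume p: "p \<in> I"
  show ?thesis
  proof (rule ccontr)
    assume "\<not> z p < nx p"
    then have z: "z p = nx p" using z_le[OF p] by simp
    define x where "x = c (z p)"
    have x: "x \<in> X" using nx_X[OF False] z by (simp add: x_def)
    define u where "u = last (v # F x)"
    have "u \<in> fan_verts" 
      using x last_in_set[of "F x"] unfolding u_def fan_verts_def by (cases "F x = []") (simp, fastforce)
    moreover have "E u x"
      using fan_path[OF x] successively_append_iff[of E "v # F x" "[x]"] by (simp add: u_def)
    ultimately show False
      using no_link_to_fan[OF p z_gt[OF p] order_refl, of u "[]"] by (simp add: x_def)
  qed
qed

end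

section \<open>Blocking vertices\<close>

context maximal_release
begin

text \<open>A witness that \<open>c (z p)\<close> cannot be released too. Its degree exceeds
  \<open>t\<close> or newly attains it; only the bound \<open>t\<close> is recorded.\<close>

definition blocker :: "nat \<Rightarrow> 'a \<Rightarrow> bool" where
  "blocker p w \<longleftrightarrow> w \<in> H \<union> insert (c (z p)) U \<and> t \<le> deg (H \<union> insert (c (z p)) U) w
     \<and> (w = c (z p) \<or> E w (c (z p)))"

text \<open>Adding \<open>c (z p)\<close> changes the degrees of its neighbours only, so a violating
  vertex neither equal nor adjacent to it would already violate releasability of
  \<open>U\<close>.\<close>

lemma blocker_exists:
  assumes "p \<in> I"
  obtains w where "blocker p w"
proof -
  let ?S = "insert (c (z p)) U"
  obtain w where w: "w \<in> H \<union> ?S"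
    "\<not> (deg (H \<union> ?S) w \<le> t \<and> (deg (H \<union> ?S) w = t \<longrightarrow> w \<in> top_outside t C))"
    using U_maximal[OF assms z_less_nx[OF assms]] unfolding releasable_def U_def by blast
  have "w = c (z p) \<or> E w (c (z p))"
  proof (rule ccontr)
    assume n: "\<not> (w = c (z p) \<or> E w (c (z p)))"
    then have "{x \<in> H \<union> ?S. E w x} = {x \<in> H \<union> U. E w x}" by auto
    then have "deg (H \<union> ?S) w = deg (H \<union> U) w" by (simp add: deg_def)
    moreover have "w \<in> H \<union> U" using w n by auto
    ultimately show False using w(2) U_releasable unfolding releasable_def U_def by simp
  qed
  moreover have "t \<le> deg (H \<union> ?S) w" using w(2) by linarith
  ultimately show thesis using w(1) that unfolding blocker_def by blast
qed

lemma blocker_notin_fan: "p \<in> I \<Longrightarrow> blocker p w \<Longrightarrow> w \<notin> fan_verts"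
  using no_link_to_fan[of p "z p" w "[]"] z_gt[of p] fan_verts_H by (auto simp: blocker_def)

text \<open>A released neighbour of \<open>c (z p)\<close> in another gap would give a double detour
  along a single edge.\<close>

lemma blocker_position:
  assumes "p \<in> I" "blocker p w"
  shows "w = c (z p) \<or> w \<in> H \<union> c ` {p<..<z p}"
proof -
  have False if "p' \<in> I" "p' \<noteq> p" "p' < j" "j < z p'" "E (c j) (c (z p))" for p' j
    using double_detour[OF assms(1) that(1) _ z_gt[OF assms(1)] order_refl that(3), of "[]"]
      E_sym[OF that(5)] that by simp
  then show ?thesis
    using assms z_gt[OF assms(1)] unfolding blocker_def U_def by fastforce
qed

text \<open>The path from \<open>w\<close> to \<open>c (z p)\<close> without its last vertex, so
  that the cases \<open>w = c (z p)\<close> and \<open>w\<close> adjacent to it are treated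
  alike.\<close>

definition entry :: "nat \<Rightarrow> 'a \<Rightarrow> 'a list" where
  "entry p w = (if w = c (z p) then [] else [w])"

lemma entry:
  assumes "p \<in> I" "blocker p w"
  shows "set (entry p w) \<subseteq> {w}" "distinct (entry p w)" "set (entry p w) \<inter> fan_verts = {}"
    "set (entry p w) \<inter> set C \<subseteq> c ` {p<..<z p}"
    "hd (entry p w @ [c (z p)]) = w" "successively E (entry p w @ [c (z p)])"
proof -
  show "set (entry p w) \<subseteq> {w}" "distinct (entry p w)" "hd (entry p w @ [c (z p)]) = w"
    by (auto simp: entry_def)
  show "set (entry p w) \<inter> fan_verts = {}"
    using blocker_notin_fan[OF assms] by (auto simp: entry_def)
  show "successively E (entry p w @ [c (z p)])"
    using assms(2) by (auto simp: entry_def blocker_def)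
  show "set (entry p w) \<inter> set C \<subseteq> c ` {p<..<z p}"
  proof (cases "w = c (z p)")
    case False
    then have "w \<in> H \<union> c ` {p<..<z p}" using blocker_position[OF assms] by simp
    then show ?thesis using False by (auto simp: entry_def)
  qed (simp add: entry_def)
qed

lemma successively_hd: "ys \<noteq> [] \<Longrightarrow> successively E (x # ys) \<longleftrightarrow> E x (hd ys) \<and> successively E ys"
  by (cases ys) auto

text \<open>Otherwise \<open>entry p w\<close> would be a link from \<open>u\<close> to
  \<open>c (z p)\<close>.\<close>

lemma blocker_not_adj_fan:
  assumes "p \<in> I" "blocker p w" "u \<in> fan_verts"
  shows "\<not> E w u"
proof
  assume "E w u"
  then have "successively E (u # entry p w @ [c (z p)])"
    using entry(5,6)[OF assms(1,2)] E_sym by (simp add: successively_hd)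
  then show False
    using no_link_to_fan[OF assms(1) z_gt[OF assms(1)] order_refl assms(3)] entry[OF assms(1,2)]
    by blast
qed

text \<open>Here \<open>q\<close> followed by \<open>entry p w\<close> would be a link from
  \<open>v\<close> to \<open>c (z p)\<close>.\<close>

lemma blocker_nbrs_disjoint_v:
  assumes "p \<in> I" "blocker p w" "q \<in> H" "E v q" "E w q"
  shows False
proof -
  have q: "q \<notin> fan_verts" using blocker_not_adj_fan[OF assms(1,2)] assms(5) by blast
  have "q \<noteq> w" using assms(5) E_irrefl by blast
  moreover have "successively E (v # (q # entry p w) @ [c (z p)])"
    using entry(5,6)[OF assms(1,2)] assms(4) E_sym[OF assms(5)] by (simp add: successively_hd)
  moreover have "v \<in> fan_verts" by (simp add: fan_verts_def)
  moreover have "distinct (q # entry p w)" using \<open>q \<noteq> w\<close> entry(1,2)[OF assms(1,2)] by auto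
  moreover have "set (q # entry p w) \<inter> fan_verts = {}" using q entry(3)[OF assms(1,2)] by simp
  moreover have "set (q # entry p w) \<inter> set C \<subseteq> c ` {p<..<z p}"
    using assms(3) entry(4)[OF assms(1,2)] by simp
  ultimately show False
    using no_link_to_fan[OF assms(1) z_gt[OF assms(1)] order_refl] by blast
qed

text \<open>The path \<open>c (z p)\<close>, \<open>w\<close>, \<open>q\<close>, \<open>w'\<close>,
  \<open>c (z p')\<close> would be a double detour, with \<open>w\<close> or \<open>w'\<close> left
  out where it equals its stop.\<close>

lemma blocker_nbrs_disjoint:
  assumes p: "p \<in> I" "p' \<in> I" "p \<noteq> p'" and w: "blocker p w" "blocker p' w'"
    and q: "q \<in> H" "E w q" "E w' q"
  shows False
proof -
  note T = entry[OF p(1) w(1)] and T' = entry[OF p(2) w(2)]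
  have dd: "successively E (c (z p) # M @ [c (z p')]) \<Longrightarrow> distinct M \<Longrightarrow>
      set M \<inter> set C \<subseteq> c ` {p<..<z p} \<union> c ` {p'<..<z p'} \<Longrightarrow> set M \<inter> fan_verts = {} \<Longrightarrow> False" for M
    using double_detour[OF p z_gt[OF p(1)] order_refl z_gt[OF p(2)] order_refl] by blast
  have qf: "q \<notin> fan_verts" using blocker_not_adj_fan[OF p(1) w(1)] q by blast
  have qw: "q \<noteq> w" "q \<noteq> w'" using q E_irrefl by auto
  have adj: "w \<noteq> c (z p) \<Longrightarrow> E (c (z p)) w" "w' \<noteq> c (z p') \<Longrightarrow> E w' (c (z p'))"
    using w E_sym by (auto simp: blocker_def)
  show False
  proof (cases "w = w'")
    case False
    have "successively E (c (z p) # (entry p w @ [q] @ entry p' w') @ [c (z p')])"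
      using adj q E_sym by (auto simp: entry_def)
    moreover have "distinct (entry p w @ [q] @ entry p' w')"
      using qw False by (auto simp: entry_def)
    moreover have "set (entry p w @ [q] @ entry p' w') \<inter> set C \<subseteq> c ` {p<..<z p} \<union> c ` {p'<..<z p'}"
      using T(4) T'(4) q(1) by auto
    moreover have "set (entry p w @ [q] @ entry p' w') \<inter> fan_verts = {}"
      using T(3) T'(3) qf by auto
    ultimately show False by (rule dd)
  next
    \<comment> \<open>If one vertex blocks both gaps, \<open>q\<close> is bypassed. The gaps with
      their stops are disjoint, so \<open>w\<close> lies off \<open>C\<close> and joins the two
      stops by itself.\<close>
    case True
    have "c ` {p1<..z p1} \<inter> c ` {p2<..z p2} = {}" if "p1 \<in> I" "p2 \<in> I" "p1 < p2" for p1 p2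
      using that nx_le_next[OF that] z_less_nx[OF that(1)] z_le_n[OF that(2)] I_less[OF that(2)]
      by (intro c_image_disjoint) auto
    from this[OF p(1,2)] this[OF p(2,1)]
    have disj: "c ` {p<..z p} \<inter> c ` {p'<..z p'} = {}" using p(3) by (auto simp: Int_commute neq_iff)
    have "c (z p) \<in> c ` {p<..z p}" "c (z p') \<in> c ` {p'<..z p'}" using z_gt p by auto
    moreover from this have "w \<in> H \<union> c ` {p<..z p}" "w \<in> H \<union> c ` {p'<..z p'}"
      using blocker_position[OF p(1) w(1)] blocker_position[OF p(2) w(2)] True by auto
    ultimately have "w \<noteq> c (z p)" "w \<noteq> c (z p')" using disj c_in_C by (metis DiffD2 UnE disjoint_iff)+
    then have "successively E (c (z p) # [w] @ [c (z p')])" "entry p w = [w]"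
      using adj True by (auto simp: entry_def)
    then show False using dd[of "[w]"] T(3,4) by auto
  qed
qed

text \<open>A neighbour in another gap gives a double detour. Within the gap \<open>detour\<close>
  lets an edge join only consecutive positions, and a path through one vertex off \<open>C\<close>
  span at most two steps. A blocker inside the gap thus sits at \<open>z p - 1\<close>, with
  neighbours no lower than \<open>z p - 2\<close>.\<close>

lemma blocker_nbrs_in_U:
  assumes p: "p \<in> I" and w: "blocker p w" and y: "y \<in> insert (c (z p)) U" "E w y"
  shows "y \<in> c ` {z p - 2..z p}"
proof -
  note T = entry[OF p w]
  show ?thesis
  proof (cases "y = c (z p)")
    case False
    then obtain p' j where j: "p' \<in> I" "p' < j" "j < z p'" "y = c j" using y by (auto simp: U_def)
    have "p' = p"
    proof (rule ccontr)
      assume "p' \<noteq> p"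
      have "successively E (c (z p) # rev (entry p w))"
        using w E_sym by (auto simp: entry_def blocker_def)
      then have "successively E (c (z p) # entry p w @ [c j])"
        using y(2) j(4) w by (auto simp: entry_def)
      moreover have "set (entry p w) \<inter> set C \<subseteq> c ` {p<..<z p} \<union> c ` {p'<..<j}" using T(4) by (rule le_supI1)
      ultimately show False
        using double_detour[OF p j(1) _ z_gt[OF p] order_refl j(2) less_imp_le[OF j(3)], of "entry p w"]
          \<open>p' \<noteq> p\<close> T(2,3) by blast
    qed
    note j = j[unfolded this]
    have short: "j' \<ge> i - 1" if "p < j'" "j' < i" "i \<le> z p" "E (c j') (c i)" for i j'
      using detour(2)[OF p _ that(2,3), of "[]"] that by simp
    consider "w = c (z p)" | "w \<in> H" "w \<noteq> c (z p)" | i where "p < i" "i < z p" "w = c i"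
      using blocker_position[OF p w] by force
    then have "z p - 2 \<le> j"
    proof cases
      case 1
      then show ?thesis using short[OF j(2,3)] E_sym[OF y(2)] j(4) by simp
    next
      case 2
      then have "successively E (c j # [w] @ [c (z p)])"
        using w y(2) j(4) E_sym by (auto simp: blocker_def)
      then have "z p - j \<le> Suc (length [w])"
        using detour(2)[OF p less_imp_le[OF j(2)] j(3) order_refl, of "[w]"] 2 by simp
      then show ?thesis by simp
    next
      case (3 i)
      have "w \<noteq> c (z p)" using 3 z_le_n[OF p] c_inj[of i "z p"] by simp
      then have "E (c i) (c (z p))" using w 3 by (simp add: blocker_def)
      then have i: "z p - 1 \<le> i" using short[OF 3(1,2)] by simp
      show ?thesis
      proof (cases "j < i")
        case True
        then have "i - 1 \<le> j" using short[OF j(2) True] 3 E_sym[OF y(2)] j(4) by simp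
        then show ?thesis using i by simp
      qed (use i in simp)
    qed
    then show ?thesis using j by auto
  qed simp
qed

lemma blocker_deg:
  assumes p: "p \<in> I" and w: "blocker p w"
  shows "t - 3 \<le> deg H w"
proof -
  have "{x \<in> H \<union> insert (c (z p)) U. E w x} \<subseteq> {x \<in> H. E w x} \<union> c ` {z p - 2..z p}"
    using blocker_nbrs_in_U[OF p w] by blast
  then have "card {x \<in> H \<union> insert (c (z p)) U. E w x} \<le> card ({x \<in> H. E w x} \<union> c ` {z p - 2..z p})"
    using finite_V by (intro card_mono) auto
  also have "\<dots> \<le> card {x \<in> H. E w x} + card (c ` {z p - 2..z p})" by (rule card_Un_le)
  also have "card (c ` {z p - 2..z p}) \<le> 3"
    using card_image_le[of "{z p - 2..z p}" c] by simp
  finally have "deg (H \<union> insert (c (z p)) U) w \<le> deg H w + 3" by (simp only: deg_def)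
  then show ?thesis using w unfolding blocker_def by linarith
qed

text \<open>The neighbourhoods in \<open>H\<close> of \<open>v\<close> and of one blocker for each
  of the \<open>k\<close> gaps are pairwise disjoint.\<close>

lemma degree_sum: "t + k * (t - 3) \<le> card H"
proof -
  have "\<forall>p\<in>I. \<exists>w. blocker p w" using blocker_exists by blast
  then obtain w where w: "\<And>p. p \<in> I \<Longrightarrow> blocker p (w p)" by metis
  let ?N = "\<lambda>u. {x \<in> H. E u x}"
  have fin: "finite (?N u)" for u using finite_V by simp
  have disj: "?N (w p) \<inter> ?N (w p') = {}" if "p \<in> I" "p' \<in> I" "p \<noteq> p'" for p p'
    using blocker_nbrs_disjoint[OF that w w] that by blast
  have dv: "?N v \<inter> (\<Union>p\<in>I. ?N (w p)) = {}"
    using blocker_nbrs_disjoint_v[OF _ w] by blast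
  have "k * (t - 3) = (\<Sum>p\<in>I. t - 3)" using card_I by simp
  also have "\<dots> \<le> (\<Sum>p\<in>I. card (?N (w p)))"
    using blocker_deg w by (intro sum_mono) (simp add: deg_def)
  also have "\<dots> = card (\<Union>p\<in>I. ?N (w p))"
    using finite_I fin disj by (intro card_UN_disjoint[symmetric]) auto
  finally have "t + k * (t - 3) \<le> card (?N v) + card (\<Union>p\<in>I. ?N (w p))"
    using deg_v by (simp add: deg_def)
  also have "\<dots> = card (?N v \<union> (\<Union>p\<in>I. ?N (w p)))"
    using fin finite_I dv by (intro card_Un_disjoint[symmetric]) auto
  also have "\<dots> \<le> card H" using finite_V by (intro card_mono) auto
  finally show ?thesis .
qed

end

section \<open>Choice of a maximal release\<close>

lemma UN_insert_at:
  "p \<in> I \<Longrightarrow> (\<Union>q\<in>I. if q = p then insert a (f q) else f q) = insert a (\<Union>q\<in>I. f q)"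
  by (auto split: if_splits)

context minimal_configuration
begin

lemma degree_sum_le: "t + k * (t - 3) \<le> card H"
proof -
  \<comment> \<open>Admissible choices of stops; \<open>Suc\<close> is one, as it releases
    nothing.\<close>
  define P where "P z \<longleftrightarrow> (\<forall>p\<in>I. p < z p \<and> z p \<le> nx p) \<and> releasable (\<Union>p\<in>I. c ` {p<..<z p})" for z
  have "releasable {}"
    using C_bounded by (auto simp: releasable_def bounded_outside_def top_outside_def)
  moreover have "{p<..<Suc p} = {}" for p by auto
  moreover have "\<forall>p\<in>I. p < Suc p \<and> Suc p \<le> nx p" using nx_gt by (simp add: Suc_le_eq)
  ultimately have "P Suc" unfolding P_def by simp
  moreover have "\<forall>z. P z \<longrightarrow> sum z I < Suc (sum nx I)"
    by (auto simp: P_def less_Suc_eq_le intro: sum_mono)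
  \<comment> \<open>Maximising the sum of the stops suffices, as moving any single stop forward
    would raise it.\<close>
  ultimately have "\<exists>z. P z \<and> (\<forall>y. P y \<longrightarrow> sum y I \<le> sum z I)"
    using ex_has_greatest_nat[of P Suc "\<lambda>z. sum z I"] by blast
  then obtain z where z: "P z" "\<And>y. P y \<Longrightarrow> sum y I \<le> sum z I" by blast
  interpret maximal_release V E k t \<tau> C v X F z
  proof unfold_locales
    show "p < z p" "z p \<le> nx p" if "p \<in> I" for p using z(1) that by (auto simp: P_def)
    show "releasable (\<Union>p\<in>I. c ` {p<..<z p})" using z(1) by (auto simp: P_def)
    show "\<not> releasable (insert (c (z p)) (\<Union>p\<in>I. c ` {p<..<z p}))" if p: "p \<in> I" "z p < nx p" for p
    proof
      assume r: "releasable (insert (c (z p)) (\<Union>p\<in>I. c ` {p<..<z p}))"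
      let ?y = "z(p := Suc (z p))"
      have "{p<..<Suc (z p)} = insert (z p) {p<..<z p}" using z(1) p by (auto simp: P_def)
      then have "c ` {q<..<?y q} = (if q = p then insert (c (z p)) (c ` {q<..<z q}) else c ` {q<..<z q})" for q
        by simp
      then have "(\<Union>q\<in>I. c ` {q<..<?y q}) = insert (c (z p)) (\<Union>q\<in>I. c ` {q<..<z q})"
        using UN_insert_at[OF p(1), of "c (z p)" "\<lambda>q. c ` {q<..<z q}"] by presburger
      then have "P ?y" using z(1) r p by (auto simp: P_def less_Suc_eq)
      from z(2)[OF this] have "sum ?y I \<le> sum z I" .
      moreover have "sum z I < sum ?y I"
        using finite_I p by (intro sum_strict_mono_ex1) auto
      ultimately show False by simp
    qed
  qed
  show ?thesis by (rule degree_sum)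
qed

end

section \<open>Existence of minimal configurations\<close>

context simple_graph
begin

lemma cyc_rotate:
  assumes "cyc (as @ bs)"
  shows "cyc (bs @ as)"
proof (cases "as = [] \<or> bs = []")
  case False
  then have "2 \<le> length (as @ bs)" by (cases as; cases bs) auto
  then have "successively E (as @ bs)" "E (last bs) (hd as)" using assms False by (auto simp: cyc_def)
  then show ?thesis using assms False by (auto simp: cyc_def successively_append_iff)
qed (use assms in auto)

lemma bounded_outside_superset:
  assumes "bounded_outside t C" "cyc C'" "set C \<subseteq> set C'"
  shows "bounded_outside t C'" "top_outside t C' \<subseteq> top_outside t C"
proof -
  have le: "deg (V - set C') u \<le> deg (V - set C) u" for u
    using assms(3) by (intro deg_mono) auto
  have b: "deg (V - set C) u \<le> t" if "u \<in> V - set C'" for u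
    using that assms(1,3) by (auto simp: bounded_outside_def)
  show "bounded_outside t C'"
    unfolding bounded_outside_def using assms(2) b le order_trans by blast
  show "top_outside t C' \<subseteq> top_outside t C"
    using b le assms(3) unfolding top_outside_def by (auto intro: le_antisym)
qed

lemma cyc_length_le: "cyc C \<Longrightarrow> length C \<le> card V"
  by (metis card_mono cyc_def distinct_card finite_V)

text \<open>Every vertex of \<open>C\<close> is a fan end, in particular the first and the last of
  the list; the closing edge between them is replaced by their fan paths through
  \<open>v\<close>.\<close>

lemma insert_between_ends:
  assumes C: "cyc C" "2 \<le> length C" and F: "fan m (set C) v (set C) F" and v: "v \<in> V" "v \<notin> set C"
  shows "\<exists>C'. cyc C' \<and> set C \<subseteq> set C' \<and> v \<in> set C'"
proof -
  define x where "x = hd C"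
  define y where "y = last C"
  have ne: "C \<noteq> []" using C by auto
  then have xy: "x \<in> set C" "y \<in> set C" by (auto simp: x_def y_def)
  have "x \<noteq> y"
    using C ne unfolding x_def y_def cyc_def
    by (cases C) (auto split: if_splits)
  have F: "successively E (v # F x @ [x])" "successively E (v # F y @ [y])"
    "distinct (F x)" "distinct (F y)" "set (F x) \<subseteq> V - set C - {v}" "set (F y) \<subseteq> V - set C - {v}"
    "set (F x) \<inter> set (F y) = {}"
    using F xy \<open>x \<noteq> y\<close> unfolding fan_def by blast+
  define C' where "C' = C @ rev (F y) @ v # F x"
  have "set C' \<subseteq> V" "distinct C'"
    using F(3-7) C v unfolding C'_def cyc_def by auto
  moreover have "successively E C'"
  proof -
    have "successively E ((rev (F y) @ [v]))" "E y (hd (rev (F y) @ [v]))"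
      using successively_sym_rev[OF F(2)] by (cases "F y" rule: rev_cases; auto)+
    moreover have "successively E (v # F x)"
      using F(1) successively_append_iff[of E "v # F x" "[x]"] by auto
    ultimately have "successively E (rev (F y) @ v # F x)" "E y (hd (rev (F y) @ v # F x))"
      using successively_split[of E "rev (F y)" v "F x"] by (auto simp: hd_append)
    then show ?thesis
      using C ne by (auto simp: C'_def cyc_def successively_append_iff[of E C] y_def)
  qed
  moreover have "E (last C') (hd C')"
    using F(1) successively_append_iff[of E "v # F x" "[x]"] ne by (auto simp: C'_def x_def split: if_splits)
  ultimately show ?thesis by (intro exI[of _ C']) (auto simp: cyc_def C'_def)
qed

end

context k_connected_graph
begin

theorem cycle_with_sparse_complement:
  "\<exists>C. cyc C \<and> (\<forall>u\<in>V - set C. (k + 1) * deg (V - set C) u \<le> card (V - set C) + 3 * (k + 1))"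
proof -
  have "bounded_outside (card V) []"
    using finite_V by (auto simp: bounded_outside_def cyc_def deg_def intro: card_mono)
  then have ex: "\<exists>t C. bounded_outside t C" by blast
  define t where "t = (LEAST t. \<exists>C. bounded_outside t C)"
  have ext: "\<exists>C. bounded_outside t C" unfolding t_def by (rule LeastI_ex) (rule ex)
  have lt: "\<not> bounded_outside s C" if "s < t" for s C using not_less_Least that unfolding t_def by blast
  show ?thesis
  \<comment> \<open>For \<open>t \<le> 3\<close> the additive term alone covers all degrees.
    Otherwise the subtractions \<open>t - 1\<close> and \<open>t - 3\<close> are exact.\<close>
  proof (cases "t \<le> 3")
    case True
    obtain C where C: "bounded_outside t C" using ext by blast
    have "(k + 1) * deg (V - set C) u \<le> card (V - set C) + 3 * (k + 1)" if "u \<in> V - set C" for u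
    proof -
      have "deg (V - set C) u \<le> t" using C that unfolding bounded_outside_def by blast
      then have "deg (V - set C) u \<le> 3" using True by simp
      then have "(k + 1) * deg (V - set C) u \<le> (k + 1) * 3" by (rule mult_le_mono2)
      then show ?thesis by simp
    qed
    then show ?thesis using C by (auto simp: bounded_outside_def)
  next
    case False
    have top: "top_outside t C \<noteq> {}" if C: "bounded_outside t C" for C
    proof
      assume "top_outside t C = {}"
      then have "deg (V - set C) u \<noteq> t" if "u \<in> V - set C" for u
        using that by (auto simp: top_outside_def)
      then have "deg (V - set C) u \<le> t - 1" if "u \<in> V - set C" for u
        using C that unfolding bounded_outside_def
        by (metis One_nat_def Suc_pred le_neq_implies_less less_Suc_eq_le not_gr_zero not_less_zero)
      then have "bounded_outside (t - 1) C" using C by (simp add: bounded_outside_def)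
      then show False using lt[of "t - 1" C] False by simp
    qed
    obtain C0 where C0: "bounded_outside t C0"
      "\<And>C. bounded_outside t C \<Longrightarrow> card (top_outside t C0) \<le> card (top_outside t C)"
      using ext ex_has_least_nat[of "bounded_outside t" _ "\<lambda>C. card (top_outside t C)"] by blast
    define \<tau> where "\<tau> = card (top_outside t C0)"
    let ?P = "\<lambda>C. bounded_outside t C \<and> card (top_outside t C) = \<tau>"
    have "\<forall>C. ?P C \<longrightarrow> length C < Suc (card V)"
      using cyc_length_le by (auto simp: bounded_outside_def less_Suc_eq_le)
    \<comment> \<open>A longest cycle among those with least \<open>t\<close> and
      \<open>\<tau>\<close>; it is shown to have at least \<open>k\<close> vertices, so that a fan
      of \<open>k\<close> paths exists at all.\<close>
    then obtain C1 where C1: "?P C1" and C1_max: "\<And>C. ?P C \<Longrightarrow> length C \<le> length C1"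
      using ex_has_greatest_nat[of ?P C0 length] C0(1) \<tau>_def by blast
    obtain v where v: "v \<in> top_outside t C1" using top C1 by blast
    then have vV: "v \<in> V" "v \<notin> set C1" by (auto simp: top_outside_def)
    have cyc1: "cyc C1" using C1 by (simp add: bounded_outside_def)
    \<comment> \<open>A cycle containing \<open>C1\<close> leaves no more vertices of degree
      \<open>t\<close>, hence the same ones by minimality of \<open>\<tau>\<close>; so it cannot
      contain \<open>v\<close> or be longer.\<close>
    have ext1: "v \<notin> set C' \<and> length C' \<le> length C1" if C': "cyc C'" "set C1 \<subseteq> set C'" for C'
    proof -
      have b: "bounded_outside t C'" "top_outside t C' \<subseteq> top_outside t C1"
        using bounded_outside_superset[OF _ C'] C1 by auto
      have "\<tau> \<le> card (top_outside t C')" using C0(2)[OF b(1)] by (simp add: \<tau>_def)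
      then have eq: "top_outside t C' = top_outside t C1"
        using b(2) C1 finite_top_outside by (intro card_seteq) auto
      then have "v \<notin> set C'" using v by (auto simp: top_outside_def)
      then show ?thesis using C1_max b(1) eq C1 by auto
    qed
    have "k \<le> length C1"
    proof (rule ccontr)
      assume small: "\<not> k \<le> length C1"
      \<comment> \<open>A cycle with fewer than \<open>k\<close> vertices could be extended: the
        empty one to \<open>[v]\<close>, a vertex to an edge, a longer one through \<open>v\<close>
        by a fan ending at all its vertices.\<close>
      consider "length C1 = 0" | "length C1 = 1" | "2 \<le> length C1" by linarith
      then show False
      proof cases
        case 1
        then show False using ext1[of "[v]"] vV by (auto simp: cyc_def)
      next
        case 2
        then obtain x where x: "C1 = [x]" by (cases C1) auto
        then have xV: "x \<in> V" using cyc1 by (simp add: cyc_def)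
        have "x \<noteq> v" using vV x by auto
        moreover have "E\<^sup>*\<^sup>* x v"
          using connected_minus[of "{}" x v] k_pos xV vV by simp
        ultimately obtain u where "E x u" by (auto elim: converse_rtranclpE)
        then have "cyc [x, u]" using E_in_V E_sym E_irrefl by (auto simp: cyc_def)
        then show False using ext1[of "[x, u]"] x by simp
      next
        case 3
        have card1: "card (set C1) = length C1" using cyc1 by (simp add: cyc_def distinct_card)
        obtain X F where F: "fan (length C1) (set C1) v X F"
          using fan_exists[OF vV, of "length C1"] cyc1 small card1 by (auto simp: cyc_def)
        then have "X = set C1" using card1 by (intro card_subset_eq) (auto simp: fan_def)
        then show False using insert_between_ends[OF cyc1 3 _ vV] F ext1 by blast
      qed
    qed
    then obtain X F where F: "fan k (set C1) v X F"
      using fan_exists[OF vV, of k] cyc1 by (auto simp: cyc_def distinct_card)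
    let ?Q = "\<lambda>(C, v, X, F). bounded_outside t C \<and> card (top_outside t C) = \<tau>
      \<and> v \<in> top_outside t C \<and> fan k (set C) v X F"
    \<comment> \<open>Cycles have at most \<open>card V\<close> vertices, so this weight orders by
      fan length first and cycle length second.\<close>
    let ?f = "\<lambda>(C, v, X, F). fan_length X F * Suc (card V) + length C"
    have "?Q (C1, v, X, F)" using C1 v F by simp
    from ex_has_least_nat[of ?Q, OF this, of ?f]
    obtain y where y: "?Q y \<and> (\<forall>y'. ?Q y' \<longrightarrow> ?f y \<le> ?f y')" ..
    obtain C v X F where y_eq: "y = (C, v, X, F)" by (cases y)
    note Q = y[THEN conjunct1, unfolded y_eq] and Qmin = y[THEN conjunct2, THEN spec, unfolded y_eq]
    have "X \<noteq> {}" using Q k_pos by (auto simp: fan_def)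
    moreover have "X \<subseteq> set C" using Q by (auto simp: fan_def)
    ultimately obtain x where x: "x \<in> X" "x \<in> set C" by blast
    then obtain as bs where C: "C = as @ x # bs" by (metis split_list)
    define D where "D = x # bs @ as"
    have D: "set D = set C" "length D = length C" "cyc D"
      using Q cyc_rotate[of as "x # bs"] C by (auto simp: D_def bounded_outside_def)
    interpret minimal_configuration V E k t \<tau> D v X F
    proof unfold_locales
      show "\<tau> \<le> card (top_outside t C')" if "bounded_outside t C'" for C'
        using C0(2)[OF that] by (simp add: \<tau>_def)
      show "bounded_outside t D" "card (top_outside t D) = \<tau>" "v \<in> top_outside t D" "fan k (set D) v X F"
        using Q D by (auto simp: bounded_outside_def top_outside_def)
      show "D ! 0 \<in> X" using x by (simp add: D_def)
      fix C' v' X' F'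
      assume *: "bounded_outside t C'" "card (top_outside t C') = \<tau>" "v' \<in> top_outside t C'"
        "fan k (set C') v' X' F'"
      then have le: "fan_length X F * Suc (card V) + length C \<le> fan_length X' F' * Suc (card V) + length C'"
        using Qmin[of "(C', v', X', F')"] by simp
      have len: "length C' \<le> card V" using * cyc_length_le by (simp add: bounded_outside_def)
      have "\<not> fan_length X' F' < fan_length X F"
      proof
        assume "fan_length X' F' < fan_length X F"
        then have "Suc (fan_length X' F') * Suc (card V) \<le> fan_length X F * Suc (card V)"
          by (intro mult_le_mono1) simp
        then show False using le len by simp
      qed
      then show "fan_length X F < fan_length X' F' \<or>
          (fan_length X F = fan_length X' F' \<and> length D \<le> length C')"
        using le D(2) by (cases "fan_length X F = fan_length X' F'") auto
    qed
    have sum: "t + k * (t - 3) \<le> card (V - set D)" by (rule degree_sum_le)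
    have "(k + 1) * deg (V - set D) u \<le> card (V - set D) + 3 * (k + 1)" if "u \<in> V - set D" for u
    proof -
      have "deg (V - set D) u \<le> t" using C_bounded that by (auto simp: bounded_outside_def)
      then have "(k + 1) * deg (V - set D) u \<le> (k + 1) * t" by (rule mult_le_mono2)
      also have "\<dots> = t + k * (t - 3) + 3 * k"
        using False le_Suc_ex[of 3 t] by (auto simp: algebra_simps)
      also have "\<dots> \<le> card (V - set D) + 3 * (k + 1)" using sum by simp
      finally show ?thesis .
    qed
    then show ?thesis using C_cyc by blast
  qed
qed

end

section \<open>Transfer to symmetric digraphs\<close>

lemma vwalk_arcs_successively:
  "set (vwalk_arcs p) \<subseteq> R \<longleftrightarrow> successively (\<lambda>u v. (u, v) \<in> R) p"
  by (induction p rule: vwalk_arcs.induct) auto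

text \<open>Connectedness refers to the symmetric closure; as \<open>G\<close> is symmetric, the
  reversed arcs are already there.\<close>

lemma (in wf_digraph) connected_delete_verts_rtranclp:
  assumes "symmetric G" "Digraph_Component.connected (delete_verts G X)"
    and "u \<in> verts G - X" "w \<in> verts G - X"
  shows "(\<lambda>a b. a \<rightarrow> b \<and> a \<notin> X \<and> b \<notin> X)\<^sup>*\<^sup>* u w"
proof -
  have "u \<rightarrow>\<^sup>*\<^bsub>with_proj (mk_symmetric (delete_verts G X))\<^esub> w"
    using assms(2-4) by (auto simp: Digraph_Component.connected_def strongly_connected_def delete_verts_def)
  then have "(u, w) \<in> rtrancl_on (verts G - X) (parcs (mk_symmetric (delete_verts G X)))"
    by (simp add: reachable_def delete_verts_def)
  then show ?thesis
  proof (induction rule: rtrancl_on_induct)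
    case (step y z)
    then obtain e where e: "e \<in> arcs G" "tail G e \<notin> X" "head G e \<notin> X"
      "(y, z) = (tail G e, head G e) \<or> (y, z) = (head G e, tail G e)"
      by (auto simp: parcs_mk_symmetric delete_verts_def)
    then have "tail G e \<rightarrow> head G e" by (auto simp: arcs_ends_def arc_to_ends_def)
    then have "y \<rightarrow> z" using e(4) arcs_ends_symmetric[OF assms(1)] by auto
    then have "y \<rightarrow> z \<and> y \<notin> X \<and> z \<notin> X" using e by auto
    then show ?case using step.IH by (rule rtranclp.rtrancl_into_rtrancl[rotated])
  qed simp
qed

text \<open>Without parallel arcs an arc leaving \<open>u\<close> is determined by its head.\<close>

lemma (in nomulti_digraph) out_degree_delete_verts:
  assumes "u \<in> verts G - X"
  shows "out_degree (delete_verts G X) u = card {w \<in> verts G - X. u \<rightarrow> w}"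
proof -
  have "inj_on (head G) (out_arcs (delete_verts G X) u)"
    by (rule inj_onI) (auto simp: delete_verts_def arc_to_ends_def intro: no_multi_arcs)
  moreover have "head G ` out_arcs (delete_verts G X) u = {w \<in> verts G - X. u \<rightarrow> w}"
    using assms by (force simp: delete_verts_def arcs_ends_def arc_to_ends_def)
  ultimately show ?thesis unfolding out_degree_def by (metis card_image)
qed

theorem theorem1p4:
  fixes G :: "('a, 'b) pre_digraph" and k :: nat
  assumes "k \<ge> 1"
    and "graph G"
    and "k_connected k G"
  shows "\<exists>C. is_cycle G C \<and>
    max_degree (delete_verts G (set C))
      \<le> 1 / (real k + 1) * real (card (verts (delete_verts G (set C)))) + 3"
proof -
  interpret graph G by fact
  interpret S: k_connected_graph "verts G" "\<lambda>u v. u \<rightarrow>\<^bsub>G\<^esub> v" k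
  proof unfold_locales
    show "u \<in> verts G \<and> v \<in> verts G" if "u \<rightarrow>\<^bsub>G\<^esub> v" for u v using that by auto
    show "v \<rightarrow>\<^bsub>G\<^esub> u" if "u \<rightarrow>\<^bsub>G\<^esub> v" for u v 
      using that sym_arcs by (auto simp: symmetric_def dest: symD)
    show "\<not> u \<rightarrow>\<^bsub>G\<^esub> u" for u using no_loops by (auto simp: arcs_ends_def arc_to_ends_def)
    show "1 \<le> k" "k < card (verts G)" using assms by (auto simp: k_connected_def)
    show "(\<lambda>a b. a \<rightarrow>\<^bsub>G\<^esub> b \<and> a \<notin> X \<and> b \<notin> X)\<^sup>*\<^sup>* u w"
      if "X \<subseteq> verts G" "card X < k" "u \<in> verts G - X" "w \<in> verts G - X" for X u w
      using that assms(3) connected_delete_verts_rtranclp[OF sym_arcs] unfolding k_connected_def by blast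
  qed simp
  obtain C where C: "S.cyc C" and
    deg: "\<And>u. u \<in> verts G - set C \<Longrightarrow>
      (k + 1) * S.deg (verts G - set C) u \<le> card (verts G - set C) + 3 * (k + 1)"
    using S.cycle_with_sparse_complement by blast
  have "is_cycle G C"
  proof -
    \<comment> \<open>Lengths up to 2 match the degenerate cases of \<open>is_cycle\<close>; from
      length 3 on both notions ask for a closed walk without repetition.\<close>
    consider "C = []" | x where "C = [x]" | x y where "C = [x, y]" | "3 \<le> length C"
      by (cases C; cases "tl C"; cases "tl (tl C)") auto
    then show ?thesis
      using C by cases (auto simp: is_cycle_def S.cyc_def vwalk_def vwalk_arcs_successively)
  qed
  moreover have "max_degree (delete_verts G (set C))
      \<le> 1 / (real k + 1) * real (card (verts (delete_verts G (set C)))) + 3"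
  \<comment> \<open>If nothing is left outside \<open>C\<close>, the maximum degree is
    \<open>- 1 / 2\<close> by convention, below the bound \<open>3\<close>.\<close>
  proof (cases "verts G - set C = {}")
    case True
    then have "verts (delete_verts G (set C)) = {}" by (simp add: delete_verts_def)
    then show ?thesis unfolding max_degree_def by simp
  next
    case False
    let ?H = "delete_verts G (set C)"
    have H: "verts ?H = verts G - set C" by (simp add: delete_verts_def)
    have "Max (out_degree ?H ` verts ?H) \<in> out_degree ?H ` verts ?H"
      using False H by (intro Max_in) auto
    then obtain u where u: "u \<in> verts G - set C" "Max (out_degree ?H ` verts ?H) = out_degree ?H u"
      using H by auto
    have "(k + 1) * out_degree ?H u \<le> card (verts ?H) + 3 * (k + 1)"
      using deg[OF u(1)] out_degree_delete_verts[OF u(1)] H by (simp add: S.deg_def)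
    then have "real ((k + 1) * out_degree ?H u) \<le> real (card (verts ?H) + 3 * (k + 1))"
      by (simp only: of_nat_le_iff)
    then have "(real k + 1) * real (out_degree ?H u) \<le> real (card (verts ?H)) + 3 * (real k + 1)"
      by (simp add: algebra_simps)
    then have "real (out_degree ?H u) \<le> 1 / (real k + 1) * real (card (verts ?H)) + 3"
      by (simp add: field_simps)
    then show ?thesis using u(2) False H by (simp add: max_degree_def)
  qed
  ultimately show ?thesis by blast
qed

end
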